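(* Assume that $\mathcal{V}_0$ is bounded from below. Then the value function $\mathcal{V}$ satisfies, for all $0\le s<t$ and all $\rho\in\mathcal{P}_2(\mathbb{R}^d)$, $$\mathcal{V}(t,\rho)=\inf_{\substack{(\rho_\tau)\in AC^2(s,t;\mathcal{P}_2(\mathbb{R}^d))\\ \rho_t=\rho}}\left\{\mathcal{V}(s,\rho_s)+\int_s^t\int_{\mathbb{R}^d}\frac12|v(\tau,x)|^2\,\mathrm{d}\rho_\tau\,\mathrm{d}\tau+\int_s^t\mathcal{E}(\tau,\rho_\tau)\,\mathrm{d}\tau\right\}.$$
   Context: $\mathbb{R}_+=[0,\infty)$; $\mathcal{P}_2(\mathbb{R}^d)$ is the set of Borel probability measures on $\mathbb{R}^d$ with finite second moment, with the quadratic Wasserstein distance $\mathcal{W}_2$. $AC^2(s,t;\mathcal{P}_2(\mathbb{R}^d))$ is the set of absolutely continuous curves $(\rho_\tau)_{\tau\in[s,t]}$ in $(\mathcal{P}_2(\mathbb{R}^d),\mathcal{W}_2)$ with metric derivative in $L^2(s,t)$. In all infima over such curves, $v$ denotes a Borel velocity field of the curve, i.e. $\partial_\tau\rho_\tau+\nabla\cdot(\rho_\tau v(\tau,\cdot))=0$ in the sense of distributions with $\int_s^t\int|v|^2\,\mathrm{d}\rho_\tau\,\mathrm{d}\tau<\infty$, and the infimum is taken over curves and their velocity fields. $\mathcal{E}:\mathbb{R}_+\times\mathcal{P}_2(\mathbb{R}^d)\to\mathbb{R}$ is a given nonnegative function and $\mathcal{V}_0:\mathcal{P}_2(\mathbb{R}^d)\to\mathbb{R}$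 a given function. The value function is $$\mathcal{V}(t,\rho)=\inf_{\substack{(\rho_s)\in AC^2(0,t;\mathcal{P}_2(\mathbb{R}^d))\\ \rho_t=\rho}}\left\{\mathcal{V}_0(\rho_0)+\int_0^t\int_{\mathbb{R}^d}\frac12|v(s,x)|^2\,\mathrm{d}\rho_s\,\mathrm{d}s+\int_0^t\mathcal{E}(s,\rho_s)\,\mathrm{d}s\right\},\qquad \mathcal{V}(0,\rho)=\mathcal{V}_0(\rho).$$ *)

theory Defs
  imports "HOL-Probability.Probability"
begin

definition P2 :: "'a::euclidean_space measure set" where
  "P2 = {\<mu>. prob_space \<mu> \<and> sets \<mu> = sets borel \<and> integrable \<mu> (\<lambda>x. (norm x)\<^sup>2)}"

definition couplings ::
    "'a::euclidean_space measure \<Rightarrow> 'a measure \<Rightarrow> ('a \<times> 'a) measure set" where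
  "couplings \<mu> \<nu> = {\<gamma>. prob_space \<gamma> \<and> sets \<gamma> = sets borel \<and>
      distr \<gamma> borel fst = \<mu> \<and> distr \<gamma> borel snd = \<nu>}"

text \<open>Meant for arguments in \<^term>\<open>P2\<close>, where the set of couplings is nonempty and every
  transport cost is finite.\<close>

definition W2 :: "'a::euclidean_space measure \<Rightarrow> 'a measure \<Rightarrow> real" where
  "W2 \<mu> \<nu> = sqrt (INF \<gamma>\<in>couplings \<mu> \<nu>. \<integral>z. (dist (fst z) (snd z))\<^sup>2 \<partial>\<gamma>)"

text \<open>A curve on $[s,t]$ is a function on all of \<^typ>\<open>real\<close> of which only the values on
  \<^term>\<open>{s..t}\<close> matter.\<close>

definition has_metric_derivative ::
    "(real \<Rightarrow> 'a::euclidean_space measure) \<Rightarrow> real \<Rightarrow> real \<Rightarrow> bool" where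
  "has_metric_derivative \<rho> l \<tau> \<longleftrightarrow> ((\<lambda>\<sigma>. W2 (\<rho> \<sigma>) (\<rho> \<tau>) / \<bar>\<sigma> - \<tau>\<bar>) \<longlongrightarrow> l) (at \<tau>)"

definition abs_cont_curve ::
    "real \<Rightarrow> real \<Rightarrow> (real \<Rightarrow> 'a::euclidean_space measure) \<Rightarrow> bool" where
  "abs_cont_curve s t \<rho> \<longleftrightarrow> (\<forall>\<tau>\<in>{s..t}. \<rho> \<tau> \<in> P2) \<and>
     (\<exists>m::real \<Rightarrow> real. set_integrable lborel {s..t} m \<and>
        (\<forall>a b. s \<le> a \<and> a \<le> b \<and> b \<le> t \<longrightarrow> W2 (\<rho> a) (\<rho> b) \<le> (LBINT \<tau>:{a..b}. m \<tau>)))"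

definition AC2 ::
    "real \<Rightarrow> real \<Rightarrow> (real \<Rightarrow> 'a::euclidean_space measure) set" where
  "AC2 s t = {\<rho>. abs_cont_curve s t \<rho> \<and>
     (\<exists>g::real \<Rightarrow> real. (AE \<tau> in lborel. \<tau> \<in> {s<..<t} \<longrightarrow> has_metric_derivative \<rho> (g \<tau>) \<tau>) \<and>
        set_borel_measurable lborel {s<..<t} g \<and>
        set_integrable lborel {s<..<t} (\<lambda>\<tau>. (g \<tau>)\<^sup>2))}"

primrec C_k :: "nat \<Rightarrow> ('b::euclidean_space \<Rightarrow> real) \<Rightarrow> bool" where
  "C_k 0 f \<longleftrightarrow> continuous_on UNIV f"
| "C_k (Suc k) f \<longleftrightarrow>
     (\<exists>D. (\<forall>x. (f has_derivative D x) (at x)) \<and> (\<forall>h. C_k k (\<lambda>x. D x h)))"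

definition test_function ::
    "'b::euclidean_space set \<Rightarrow> ('b \<Rightarrow> real) \<Rightarrow> bool" where
  "test_function U \<phi> \<longleftrightarrow> (\<forall>k. C_k k \<phi>) \<and>
     compact (closure {z. \<phi> z \<noteq> 0}) \<and> closure {z. \<phi> z \<noteq> 0} \<subseteq> U"

text \<open>The total derivative of $\phi$ at $(\tau,x)$ in the direction $(1,v)$ is
  $\partial_\tau\phi + v\cdot\nabla\phi$, so the second condition is
  $\partial_\tau\rho_\tau+\nabla\cdot(\rho_\tau v)=0$ in the sense of distributions on
  $(s,t)\times\mathbb{R}^d$.
  For curves in \<^term>\<open>AC2 s t\<close> the third condition makes all integrals in the second one
  converge.\<close>

definition velocity_field ::
    "real \<Rightarrow> real \<Rightarrow> (real \<Rightarrow> 'a::euclidean_space measure) \<Rightarrow> (real \<Rightarrow> 'a \<Rightarrow> 'a) \<Rightarrow> bool" where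
  "velocity_field s t \<rho> v \<longleftrightarrow>
     (\<lambda>(\<tau>, x). v \<tau> x) \<in> borel_measurable (restrict_space borel ({s<..<t} \<times> UNIV)) \<and>
     (\<forall>\<phi>. test_function ({s<..<t} \<times> UNIV) \<phi> \<longrightarrow>
        (LBINT \<tau>:{s<..<t}. \<integral>x. frechet_derivative \<phi> (at (\<tau>, x)) (1, v \<tau> x) \<partial>\<rho> \<tau>) = 0) \<and>
     (\<integral>\<^sup>+\<tau>\<in>{s<..<t}. (\<integral>\<^sup>+x. ennreal ((norm (v \<tau> x))\<^sup>2) \<partial>\<rho> \<tau>) \<partial>lborel) < \<infinity>"

definition curves_ending_at ::
    "real \<Rightarrow> real \<Rightarrow> 'a::euclidean_space measure
      \<Rightarrow> ((real \<Rightarrow> 'a measure) \<times> (real \<Rightarrow> 'a \<Rightarrow> 'a)) set" where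
  "curves_ending_at s t \<mu> = {(\<rho>, v). \<rho> \<in> AC2 s t \<and> velocity_field s t \<rho> v \<and> \<rho> t = \<mu>}"

definition kinetic_action ::
    "real \<Rightarrow> real \<Rightarrow> (real \<Rightarrow> 'a::euclidean_space measure) \<Rightarrow> (real \<Rightarrow> 'a \<Rightarrow> 'a) \<Rightarrow> ereal" where
  "kinetic_action s t \<rho> v =
     enn2ereal (\<integral>\<^sup>+\<tau>\<in>{s<..<t}. (\<integral>\<^sup>+x. ennreal (1/2 * (norm (v \<tau> x))\<^sup>2) \<partial>\<rho> \<tau>) \<partial>lborel)"

text \<open>No measurability is imposed on $\mathcal{E}$, so the integral of
  $\tau\mapsto\mathcal{E}(\tau,\rho_\tau)\ge 0$ is read as \<^const>\<open>nn_integral\<close>: the Lebesgue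
  integral in $[0,\infty]$ when the integrand is measurable, the lower integral otherwise.\<close>

definition potential_action ::
    "(real \<Rightarrow> 'a::euclidean_space measure \<Rightarrow> real) \<Rightarrow> real \<Rightarrow> real
      \<Rightarrow> (real \<Rightarrow> 'a measure) \<Rightarrow> ereal" where
  "potential_action E s t \<rho> = enn2ereal (\<integral>\<^sup>+\<tau>\<in>{s<..<t}. ennreal (E \<tau> (\<rho> \<tau>)) \<partial>lborel)"

text \<open>The value function may equal $+\infty$, since $\mathcal{E}(\cdot,\rho_\cdot)$ need not be
  integrable along any curve.\<close>

definition value_function ::
    "(real \<Rightarrow> 'a::euclidean_space measure \<Rightarrow> real) \<Rightarrow> ('a measure \<Rightarrow> real)
      \<Rightarrow> real \<Rightarrow> 'a measure \<Rightarrow> ereal" where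
  "value_function E V0 t \<mu> =
     (if t = 0 then ereal (V0 \<mu>)
      else (INF (\<rho>, v)\<in>curves_ending_at 0 t \<mu>.
              ereal (V0 (\<rho> 0)) + kinetic_action 0 t \<rho> v + potential_action E 0 t \<rho>))"

end

theory Submission
  imports Defs
begin

text \<open>
  The identity is the dynamic programming principle: a curve on \<open>[0, t]\<close> is the same as a pair of
  curves on \<open>[0, s]\<close> and \<open>[s, t]\<close> that meet at time \<open>s\<close>, and the action of the whole is the sum of
  the actions of the parts. Minimising over the first part with the meeting point fixed gives the
  value at time \<open>s\<close>. For \<open>s = 0\<close> the identity is the definition of the value function.

  The action is additive in time for arbitrary integrands, measurable or not
  (\<open>nn_integral_Un_disjoint\<close>), and restricting a curve to a subinterval is elementary
  (\<open>curves_ending_at_restrict\<close>). The substance is that curves and their velocity fields can be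
  concatenated (\<open>curves_ending_at_concat\<close>), which rests on two facts.

  The first is the triangle inequality for the Wasserstein distance (\<open>W2_triangle\<close>), by which the
  concatenated curve is absolutely continuous across the junction. It is proved by gluing
  couplings. Instead of disintegrating along the common marginal, the space is cut into small
  cells and the couplings are glued cell by cell, which introduces an arbitrarily small error
  (\<open>approximate_gluing\<close>).

  The second is that the concatenated field satisfies the continuity equation across the junction
  (\<open>velocity_field_concat\<close>). A test function there need not vanish at time \<open>s\<close>, while the
  equations on the two pieces are only known for test functions that do. Multiplying by steep
  smooth cutoffs in time shows that for any smooth \<open>\<phi>\<close> of compact support the weak equation on
  \<open>[a, b]\<close> holds with boundary terms \<open>\<integral> \<phi> (b, x) d\<rho> b - \<integral> \<phi> (a, x) d\<rho> a\<close>
  (\<open>continuity_equation_boundary_terms\<close>); at the junction these cancel. The limit uses that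
  integrals of Lipschitz functions are continuous along the curve
  (\<open>continuous_on_integral_along_curve\<close>).
\<close>

section \<open>Smooth functions and flat cutoffs\<close>

lemma C_k_const: "C_k k (\<lambda>_::'b::euclidean_space. c)"
proof (induction k arbitrary: c)
  case (Suc k)
  have "((\<lambda>_::'b. c) has_derivative (\<lambda>_. 0)) (at x)" for x
    by simp
  then show ?case
    using Suc by (auto intro!: exI[of _ "\<lambda>_ _. 0"])
qed simp

lemma C_k_SucD: "C_k (Suc k) f \<Longrightarrow> C_k k f"
proof (induction k arbitrary: f)
  case 0
  then obtain D where "\<And>x. (f has_derivative D x) (at x)"
    by auto
  then show ?case
    by (auto intro!: continuous_at_imp_continuous_on has_derivative_continuous)
next
  case (Suc k)
  then obtain D where D: "\<And>x. (f has_derivative D x) (at x)" "\<And>h. C_k (Suc k) (\<lambda>x. D x h)"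
    by (subst (asm) C_k.simps(2)) blast
  from D(2) have "\<And>h. C_k k (\<lambda>x. D x h)"
    by (rule Suc.IH)
  with D(1) show ?case
    by auto
qed

lemma C_k_add: "C_k k f \<Longrightarrow> C_k k g \<Longrightarrow> C_k k (\<lambda>x. f x + g x)"
proof (induction k arbitrary: f g)
  case 0
  then show ?case by (simp add: continuous_on_add)
next
  case (Suc k)
  from Suc.prems obtain D D' where
    D: "\<And>x. (f has_derivative D x) (at x)" "\<And>h. C_k k (\<lambda>x. D x h)" and
    D': "\<And>x. (g has_derivative D' x) (at x)" "\<And>h. C_k k (\<lambda>x. D' x h)"
    by auto
  have "((\<lambda>x. f x + g x) has_derivative (\<lambda>h. D x h + D' x h)) (at x)" for x
    by (intro has_derivative_add D D')
  moreover have "C_k k (\<lambda>x. D x h + D' x h)" for h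
    by (intro Suc.IH D D')
  ultimately show ?case
    by (auto intro!: exI[of _ "\<lambda>x h. D x h + D' x h"])
qed

lemma C_k_mult: "C_k k f \<Longrightarrow> C_k k g \<Longrightarrow> C_k k (\<lambda>x. f x * g x)"
proof (induction k arbitrary: f g)
  case 0
  then show ?case by (simp add: continuous_on_mult)
next
  case (Suc k)
  from Suc.prems obtain D D' where
    D: "\<And>x. (f has_derivative D x) (at x)" "\<And>h. C_k k (\<lambda>x. D x h)" and
    D': "\<And>x. (g has_derivative D' x) (at x)" "\<And>h. C_k k (\<lambda>x. D' x h)"
    by auto
  have fg: "C_k k f" "C_k k g"
    using Suc.prems by (blast intro: C_k_SucD)+
  have "((\<lambda>x. f x * g x) has_derivative (\<lambda>h. f x * D' x h + D x h * g x)) (at x)" for x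
    by (rule has_derivative_mult[OF D(1) D'(1)])
  moreover have "C_k k (\<lambda>x. f x * D' x h + D x h * g x)" for h
    by (intro C_k_add Suc.IH D D' fg)
  ultimately show ?case
    by (auto intro!: exI[of _ "\<lambda>x h. f x * D' x h + D x h * g x"])
qed

lemma C_k_affine:
  assumes "bounded_linear l"
  shows "C_k k (\<lambda>x. l x + c)"
proof (cases k)
  case 0
  then show ?thesis
    using assms by (simp add: linear_continuous_on continuous_on_add)
next
  case (Suc j)
  have "((\<lambda>x. l x + c) has_derivative l) (at x)" for x
    using has_derivative_add[OF bounded_linear.has_derivative[OF assms has_derivative_ident]
        has_derivative_const[of c]] by simp
  then show ?thesis
    using Suc by (auto intro!: exI[of _ "\<lambda>_. l"] C_k_const)
qed

text \<open>The outer function is given with all its derivatives, as a sequence \<open>F\<close>, because the chain rule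
  turns \<open>F n\<close> into \<open>F (Suc n)\<close>; the induction on the order has to range over all of them.\<close>
lemma C_k_compose:
  assumes F: "\<And>n x. (F n has_real_derivative F (Suc n) x) (at x)"
    and "C_k k \<psi>"
  shows "C_k k (\<lambda>z. F n (\<psi> z))"
  using assms(2)
proof (induction k arbitrary: n)
  case 0
  have "continuous_on UNIV (F n)"
    using F by (auto intro!: continuous_at_imp_continuous_on DERIV_isCont)
  with 0 show ?case
    by (auto intro: continuous_on_compose2)
next
  case (Suc k)
  from Suc.prems obtain D where
    D: "\<And>x. (\<psi> has_derivative D x) (at x)" "\<And>h. C_k k (\<lambda>x. D x h)"
    by auto
  have "((\<lambda>z. F n (\<psi> z)) has_derivative (\<lambda>h. F (Suc n) (\<psi> z) * D z h)) (at z)" for z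
    using has_derivative_compose[OF D(1) F[unfolded has_field_derivative_def]] by simp
  moreover have "C_k k (\<lambda>z. F (Suc n) (\<psi> z) * D z h)" for h
    using C_k_SucD[OF Suc.prems] by (intro C_k_mult D Suc.IH)
  ultimately show ?case
    by (auto intro!: exI[of _ "\<lambda>z h. F (Suc n) (\<psi> z) * D z h"])
qed

text \<open>For \<open>x > 0\<close> the derivative of \<open>p (1/x) exp (- 1/x)\<close> is \<open>q (1/x) exp (- 1/x)\<close> with
  \<open>q(u) = u\<^sup>2 (p(u) - p'(u))\<close>, so every derivative of \<open>exp (- 1/x)\<close> has this form.\<close>
primrec flat_exp_poly :: "nat \<Rightarrow> real poly" where
  "flat_exp_poly 0 = 1"
| "flat_exp_poly (Suc n) = monom 1 2 * (flat_exp_poly n - pderiv (flat_exp_poly n))"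

text \<open>The \<open>n\<close>-th derivative of the smooth function that is \<open>exp (- 1/x)\<close> for \<open>x > 0\<close> and \<open>0\<close>
  otherwise. It rises monotonically from \<open>0\<close> to the limit \<open>1\<close> at infinity, so it serves as a
  smooth step without further normalisation.\<close>
definition flat_exp :: "nat \<Rightarrow> real \<Rightarrow> real" where
  "flat_exp n x = (if x \<le> 0 then 0 else poly (flat_exp_poly n) (1 / x) * exp (- (1 / x)))"

text \<open>Substituting \<open>u = 1/x\<close>, an exponential beats every polynomial. This glues the two branches
  smoothly at \<open>0\<close>.\<close>
lemma flat_exp_tendsto_0: "((\<lambda>x. poly p (1 / x) * exp (- (1 / x))) \<longlongrightarrow> 0) (at_right (0::real))"
proof -
  have "((\<lambda>u::real. poly p u * exp (- u)) \<longlongrightarrow> 0) at_top"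
  proof -
    have *: "((\<lambda>u::real. coeff p i * u ^ i * exp (- u)) \<longlongrightarrow> 0) at_top" for i
      using tendsto_mult[OF tendsto_const tendsto_power_div_exp_0[of i], of "coeff p i"]
      by (simp add: exp_minus field_simps)
    have "((\<lambda>u::real. \<Sum>i\<le>degree p. coeff p i * u ^ i * exp (- u)) \<longlongrightarrow> (\<Sum>i\<le>degree p. 0)) at_top"
      by (intro tendsto_sum *)
    then show ?thesis
      by (simp add: poly_altdef sum_distrib_right)
  qed
  then have "((\<lambda>x. poly p (inverse x) * exp (- (inverse x))) \<longlongrightarrow> 0) (at_right (0::real))"
    by (rule filterlim_compose[OF _ filterlim_inverse_at_top_right])
  then show ?thesis
    by (simp add: inverse_eq_divide)
qed

lemma flat_exp_has_derivative: "(flat_exp n has_real_derivative flat_exp (Suc n) x) (at x)"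
proof -
  consider "x < 0" | "x > 0" | "x = 0" by linarith
  then show ?thesis
  proof cases
    case 1
    have "((\<lambda>_. 0) has_real_derivative 0) (at x)" by simp
    moreover have "\<forall>\<^sub>F y in nhds x. flat_exp n y = 0"
      using eventually_nhds_in_open[of "{..<0}" x] 1
      by (auto simp: flat_exp_def elim!: eventually_mono)
    ultimately have "(flat_exp n has_real_derivative 0) (at x)"
      by (subst DERIV_cong_ev[OF refl _ refl])
    with 1 show ?thesis by (simp add: flat_exp_def)
  next
    case 2
    let ?p = "flat_exp_poly n"
    have "((\<lambda>y. poly ?p (1 / y) * exp (- (1 / y))) has_real_derivative
       (poly (pderiv ?p) (1/x) * (- 1 / x^2) * exp (-(1/x)) + poly ?p (1/x) * (exp (-(1/x)) * (1 / x^2)))) (at x)"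
      using 2 by (auto intro!: derivative_eq_intros simp: power2_eq_square)
    also have "(poly (pderiv ?p) (1/x) * (- 1 / x^2) * exp (-(1/x)) + poly ?p (1/x) * (exp (-(1/x)) * (1 / x^2)))
      = flat_exp (Suc n) x"
      using 2 by (simp add: flat_exp_def poly_monom field_simps)
    finally have d: "((\<lambda>y. poly ?p (1 / y) * exp (- (1 / y))) has_real_derivative flat_exp (Suc n) x) (at x)" .
    have "\<forall>\<^sub>F y in nhds x. flat_exp n y = poly ?p (1 / y) * exp (- (1 / y))"
      using eventually_nhds_in_open[of "{0<..}" x] 2
      by (auto simp: flat_exp_def elim!: eventually_mono)
    with d show ?thesis
      by (subst DERIV_cong_ev[OF refl _ refl])
  next
    case 3
    have l: "((\<lambda>y. (flat_exp n y - flat_exp n 0) / (y - 0)) \<longlongrightarrow> 0) (at_left 0)"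
      by (rule tendsto_eventually)
        (auto simp: flat_exp_def eventually_at_left_field intro!: exI[of _ "-1"])
    \<comment> \<open>The difference quotient is again a polynomial in \<open>1/y\<close> times \<open>exp (- 1/y)\<close>.\<close>
    have "((\<lambda>y. (flat_exp n y - flat_exp n 0) / (y - 0)) \<longlongrightarrow> 0) (at_right 0)"
    proof (rule Lim_transform_eventually[OF flat_exp_tendsto_0[of "monom 1 1 * flat_exp_poly n"]])
      show "\<forall>\<^sub>F y in at_right 0. poly (monom 1 1 * flat_exp_poly n) (1 / y) * exp (- (1 / y)) =
          (flat_exp n y - flat_exp n 0) / (y - 0)"
        by (auto simp: flat_exp_def eventually_at_right_field poly_monom intro!: exI[of _ 1])
    qed
    with l have "((\<lambda>y. (flat_exp n y - flat_exp n 0) / (y - 0)) \<longlongrightarrow> 0) (at 0)"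
      by (simp add: filterlim_split_at_real)
    then show ?thesis
      using 3 by (simp add: has_field_derivative_iff flat_exp_def)
  qed
qed

lemma C_k_flat_exp: "C_k k \<psi> \<Longrightarrow> C_k k (\<lambda>z. flat_exp n (\<psi> z))"
  by (rule C_k_compose[where F = flat_exp, OF flat_exp_has_derivative])

lemma continuous_on_flat_exp [continuous_intros]:
  "continuous_on S f \<Longrightarrow> continuous_on S (\<lambda>x. flat_exp n (f x))"
  by (rule continuous_on_compose2[OF DERIV_continuous_on[of UNIV, OF flat_exp_has_derivative] _ subset_UNIV])

lemma borel_measurable_flat_exp [measurable]: "flat_exp n \<in> borel_measurable borel"
  by (intro borel_measurable_continuous_onI continuous_on_flat_exp continuous_on_id)

lemma flat_exp_nonpos: "x \<le> 0 \<Longrightarrow> flat_exp n x = 0"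
  by (simp add: flat_exp_def)

lemma flat_exp_0_bounds: "0 \<le> flat_exp 0 x" "flat_exp 0 x \<le> 1"
  by (auto simp: flat_exp_def)

lemma flat_exp_1_nonneg: "0 \<le> flat_exp (Suc 0) x"
  by (auto simp: flat_exp_def poly_monom)

lemma flat_exp_0_tendsto_1: "(flat_exp 0 \<longlongrightarrow> 1) at_top"
proof (rule Lim_transform_eventually)
  have "((\<lambda>x. exp (- (1 / x))) \<longlongrightarrow> exp (- 0)) (at_top::real filter)"
    by (intro tendsto_intros tendsto_divide_0[OF tendsto_const] filterlim_at_top_imp_at_infinity filterlim_ident)
  then show "((\<lambda>x. exp (- (1 / x))) \<longlongrightarrow> 1) (at_top::real filter)" by simp
  show "\<forall>\<^sub>F x in at_top. exp (- (1 / x)) = flat_exp 0 x"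
    using eventually_gt_at_top[of 0] by eventually_elim (simp add: flat_exp_def)
qed

text \<open>The derivative of the step is a probability density, because the step increases from \<open>0\<close> to
  \<open>1\<close>.\<close>
lemma has_bochner_integral_flat_exp_1: "has_bochner_integral lborel (flat_exp (Suc 0)) 1"
proof (rule has_bochner_integral_nn_integral)
  have "(\<integral>\<^sup>+x. ennreal (flat_exp (Suc 0) x) \<partial>lborel) =
      (\<integral>\<^sup>+x. ennreal (flat_exp (Suc 0) x) * indicator {0..} x \<partial>lborel)"
    by (rule nn_integral_cong) (auto simp: flat_exp_def indicator_def)
  also have "\<dots> = ennreal (1 - flat_exp 0 0)"
    by (rule nn_integral_FTC_atLeast[OF _ flat_exp_has_derivative flat_exp_1_nonneg flat_exp_0_tendsto_1]) simp
  finally show "(\<integral>\<^sup>+x. ennreal (flat_exp (Suc 0) x) \<partial>lborel) = ennreal 1"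
    by (simp add: flat_exp_def)
qed (auto intro: flat_exp_1_nonneg)

text \<open>The derivative of the steep step \<open>flat_exp 0 (N (\<tau> - a) - 1)\<close> is an approximate identity at
  \<open>a\<close>, concentrated on the right of \<open>a\<close>. The substitution \<open>\<tau> = a + u/N\<close> turns it into the fixed
  density \<open>flat_exp 1 (u - 1)\<close>, and the other factors converge boundedly to \<open>1\<close> and \<open>g a\<close>. The
  second cutoff factor, which acts near \<open>b\<close>, is carried along because it multiplies the first one
  in the product rule.\<close>
lemma cutoff_derivative_concentrates:
  fixes g :: "real \<Rightarrow> real"
  assumes ab: "a < b" and g: "continuous_on {a..b} g"
  shows "(\<lambda>n. LBINT \<tau>:{a<..<b}. real (Suc n) * flat_exp (Suc 0) (real (Suc n) * (\<tau> - a) - 1) *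
      flat_exp 0 (real (Suc n) * (b - \<tau>) - 1) * g \<tau>) \<longlonglongrightarrow> g a"
proof -
  \<comment> \<open>Extending \<open>g\<close> by zero lets the substituted integrals run over the whole line.\<close>
  define G where "G \<tau> = indicator {a<..<b} \<tau> * g \<tau>" for \<tau>
  have [measurable]: "G \<in> borel_measurable borel"
    unfolding G_def using borel_measurable_continuous_on_indicator[of "{a<..<b}" g]
      continuous_on_subset[OF g, of "{a<..<b}"] by (simp add: greaterThanLessThan_subseteq_atLeastAtMost_iff)
  obtain B where B: "\<And>\<tau>. \<bar>G \<tau>\<bar> \<le> B"
  proof -
    have "bounded (g ` {a..b})"
      by (intro compact_imp_bounded compact_continuous_image g) auto
    then obtain B where "B > 0" "\<forall>x\<in>g ` {a..b}. norm x \<le> B"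
      unfolding bounded_pos by blast
    then show thesis
      by (intro that[of B]) (auto simp: G_def indicator_def)
  qed
  define K where "K n u = flat_exp (Suc 0) (u - 1) * flat_exp 0 (real (Suc n) * (b - a) - u - 1) * G (a + u / real (Suc n))" for n u
  have "(LBINT \<tau>:{a<..<b}. real (Suc n) * flat_exp (Suc 0) (real (Suc n) * (\<tau> - a) - 1) *
      flat_exp 0 (real (Suc n) * (b - \<tau>) - 1) * g \<tau>) = (\<integral>u. K n u \<partial>lborel)" for n
  proof -
    define N where "N = real (Suc n)"
    have N: "N > 0" by (simp add: N_def)
    have "(LBINT \<tau>:{a<..<b}. N * flat_exp (Suc 0) (N * (\<tau> - a) - 1) * flat_exp 0 (N * (b - \<tau>) - 1) * g \<tau>) =
      (\<integral>\<tau>. N * flat_exp (Suc 0) (N * (\<tau> - a) - 1) * flat_exp 0 (N * (b - \<tau>) - 1) * G \<tau> \<partial>lborel)"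
      unfolding set_lebesgue_integral_def G_def by (intro Bochner_Integration.integral_cong) auto
    also have "\<dots> = \<bar>1 / N\<bar> *\<^sub>R (\<integral>u. N * flat_exp (Suc 0) (N * ((a + 1 / N * u) - a) - 1) *
         flat_exp 0 (N * (b - (a + 1 / N * u)) - 1) * G (a + 1 / N * u) \<partial>lborel)"
      using N by (intro lborel_integral_real_affine) auto
    also have "(\<integral>u. N * flat_exp (Suc 0) (N * ((a + 1 / N * u) - a) - 1) *
         flat_exp 0 (N * (b - (a + 1 / N * u)) - 1) * G (a + 1 / N * u) \<partial>lborel) = (\<integral>u. N * K n u \<partial>lborel)"
      using N by (intro Bochner_Integration.integral_cong)
        (simp_all add: K_def N_def[symmetric] algebra_simps del: of_nat_Suc)
    finally show ?thesis
      using N unfolding N_def[symmetric] by simp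
  qed
  moreover have "(\<lambda>n. \<integral>u. K n u \<partial>lborel) \<longlonglongrightarrow> (\<integral>u. flat_exp (Suc 0) (u - 1) * g a \<partial>lborel)"
  proof (rule integral_dominated_convergence)
    have "integrable lborel (\<lambda>u. flat_exp (Suc 0) (- 1 + 1 * u))"
      using has_bochner_integral_flat_exp_1 by (intro lborel_integrable_real_affine) (auto simp: has_bochner_integral_iff)
    then show "integrable lborel (\<lambda>u. flat_exp (Suc 0) (u - 1) * B)" by simp
    show "AE u in lborel. norm (K n u) \<le> flat_exp (Suc 0) (u - 1) * B" for n
    proof (rule AE_I2)
      fix u :: real
      have "\<bar>K n u\<bar> = flat_exp (Suc 0) (u - 1) * (flat_exp 0 (real (Suc n) * (b - a) - u - 1) * \<bar>G (a + u / real (Suc n))\<bar>)"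
        unfolding K_def by (simp add: abs_mult flat_exp_0_bounds flat_exp_1_nonneg)
      also have "\<dots> \<le> flat_exp (Suc 0) (u - 1) * (1 * B)"
        by (intro mult_left_mono mult_mono B flat_exp_0_bounds flat_exp_1_nonneg) auto
      finally show "norm (K n u) \<le> flat_exp (Suc 0) (u - 1) * B" by simp
    qed
    show "AE u in lborel. (\<lambda>n. K n u) \<longlonglongrightarrow> flat_exp (Suc 0) (u - 1) * g a"
    proof (rule AE_I2)
      fix u :: real
      show "(\<lambda>n. K n u) \<longlonglongrightarrow> flat_exp (Suc 0) (u - 1) * g a"
      proof (cases "u \<le> 1")
        case True
        then show ?thesis by (simp add: K_def flat_exp_nonpos)
      next
        case False
        have N: "filterlim (\<lambda>n. real (Suc n)) at_top sequentially"
          by (rule filterlim_compose[OF filterlim_real_sequentially filterlim_Suc])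
        have 1: "(\<lambda>n. flat_exp 0 (real (Suc n) * (b - a) - u - 1)) \<longlonglongrightarrow> 1"
        proof (rule filterlim_compose[OF flat_exp_0_tendsto_1])
          have "filterlim (\<lambda>n. - (u + 1) + (b - a) * real (Suc n)) at_top sequentially"
            using ab by (intro filterlim_tendsto_add_at_top[OF tendsto_const]
              filterlim_tendsto_pos_mult_at_top[OF tendsto_const _ N]) simp
          then show "filterlim (\<lambda>n. real (Suc n) * (b - a) - u - 1) at_top sequentially"
            by (simp add: algebra_simps)
        qed
        have "(\<lambda>n. a + u / real (Suc n)) \<longlonglongrightarrow> a + 0"
          by (intro tendsto_intros tendsto_divide_0[OF tendsto_const] filterlim_at_top_imp_at_infinity N)
        then have a: "(\<lambda>n. a + u / real (Suc n)) \<longlonglongrightarrow> a" by simp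
        have ev: "\<forall>\<^sub>F n in sequentially. a + u / real (Suc n) \<in> {a<..<b}"
          using False by (intro eventually_mono[OF order_tendstoD(2)[OF a ab]]) simp
        have "(\<lambda>n. g (a + u / real (Suc n))) \<longlonglongrightarrow> g a"
          using ab by (intro continuous_on_tendsto_compose[OF g a] eventually_mono[OF ev]) auto
        then have 2: "(\<lambda>n. G (a + u / real (Suc n))) \<longlonglongrightarrow> g a"
          by (rule Lim_transform_eventually) (rule eventually_mono[OF ev], simp add: G_def)
        show ?thesis
          using tendsto_mult[OF tendsto_mult[OF tendsto_const 1] 2] unfolding K_def by simp
      qed
    qed
  qed (auto simp: K_def)
  moreover have "(\<integral>u. flat_exp (Suc 0) (u - 1) * g a \<partial>lborel) = g a"
  proof -
    have "(\<integral>u. flat_exp (Suc 0) u \<partial>lborel) = \<bar>1\<bar> *\<^sub>R (\<integral>u. flat_exp (Suc 0) (- 1 + 1 * u) \<partial>lborel)"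
      by (intro lborel_integral_real_affine) simp
    then show ?thesis
      using has_bochner_integral_flat_exp_1 by (simp add: has_bochner_integral_iff)
  qed
  ultimately show ?thesis by (simp only:)
qed

text \<open>The reflection \<open>\<tau> \<mapsto> a + b - \<tau>\<close> exchanges the two ends.\<close>
lemma cutoff_derivative_concentrates_right:
  fixes g :: "real \<Rightarrow> real"
  assumes ab: "a < b" and g: "continuous_on {a..b} g"
  shows "(\<lambda>n. LBINT \<tau>:{a<..<b}. real (Suc n) * flat_exp 0 (real (Suc n) * (\<tau> - a) - 1) *
      flat_exp (Suc 0) (real (Suc n) * (b - \<tau>) - 1) * g \<tau>) \<longlonglongrightarrow> g b"
proof -
  have "continuous_on {a..b} (\<lambda>\<tau>. g (a + b - \<tau>))"
    by (intro continuous_on_compose2[OF g] continuous_intros) auto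
  note lim = cutoff_derivative_concentrates[OF ab this]
  have "(LBINT \<tau>:{a<..<b}. N * flat_exp 0 (N * (\<tau> - a) - 1) * flat_exp (Suc 0) (N * (b - \<tau>) - 1) * g \<tau>) =
    (LBINT \<tau>:{a<..<b}. N * flat_exp (Suc 0) (N * (\<tau> - a) - 1) * flat_exp 0 (N * (b - \<tau>) - 1) * g (a + b - \<tau>))" for N
    unfolding set_lebesgue_integral_def
    by (subst lborel_integral_real_affine[where c = "-1" and t = "a + b"])
      (auto intro!: Bochner_Integration.integral_cong simp: indicator_def algebra_simps)
  with lim show ?thesis
    by (simp only: add_diff_cancel_left add_diff_cancel_right' add_diff_cancel_left')
qed

definition cutoff :: "real \<Rightarrow> real \<Rightarrow> real \<Rightarrow> real \<Rightarrow> real" where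
  "cutoff a b N \<tau> = flat_exp 0 (N * (\<tau> - a) - 1) * flat_exp 0 (N * (b - \<tau>) - 1)"

definition cutoff_deriv :: "real \<Rightarrow> real \<Rightarrow> real \<Rightarrow> real \<Rightarrow> real" where
  "cutoff_deriv a b N \<tau> =
     N * flat_exp (Suc 0) (N * (\<tau> - a) - 1) * flat_exp 0 (N * (b - \<tau>) - 1) -
     N * flat_exp 0 (N * (\<tau> - a) - 1) * flat_exp (Suc 0) (N * (b - \<tau>) - 1)"

lemma cutoff_has_derivative: "(cutoff a b N has_real_derivative cutoff_deriv a b N \<tau>) (at \<tau>)"
proof -
  have "((\<lambda>\<tau>. flat_exp 0 (N * (\<tau> - a) - 1)) has_real_derivative flat_exp (Suc 0) (N * (\<tau> - a) - 1) * N) (at \<tau>)"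
    by (rule DERIV_chain2[OF flat_exp_has_derivative]) (auto intro!: derivative_eq_intros)
  moreover have "((\<lambda>\<tau>. flat_exp 0 (N * (b - \<tau>) - 1)) has_real_derivative flat_exp (Suc 0) (N * (b - \<tau>) - 1) * (- N)) (at \<tau>)"
    by (rule DERIV_chain2[OF flat_exp_has_derivative]) (auto intro!: derivative_eq_intros)
  ultimately have "((\<lambda>\<tau>. flat_exp 0 (N * (\<tau> - a) - 1) * flat_exp 0 (N * (b - \<tau>) - 1)) has_real_derivative
     flat_exp (Suc 0) (N * (\<tau> - a) - 1) * N * flat_exp 0 (N * (b - \<tau>) - 1) +
     flat_exp (Suc 0) (N * (b - \<tau>) - 1) * (- N) * flat_exp 0 (N * (\<tau> - a) - 1)) (at \<tau>)"
    by (rule DERIV_mult)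
  then show ?thesis
    unfolding cutoff_def[abs_def] cutoff_deriv_def by (simp add: algebra_simps)
qed

lemma cutoff_bounds: "0 \<le> cutoff a b N \<tau>" "cutoff a b N \<tau> \<le> 1"
  unfolding cutoff_def by (auto intro!: mult_nonneg_nonneg mult_le_one flat_exp_0_bounds)

lemma continuous_on_cutoff:
  "continuous_on S (cutoff a b N)" "continuous_on S (cutoff_deriv a b N)"
  unfolding cutoff_def[abs_def] cutoff_deriv_def[abs_def] by (intro continuous_intros)+

lemma cutoff_tendsto_1:
  assumes "a < \<tau>" "\<tau> < b"
  shows "(\<lambda>n. cutoff a b (real (Suc n)) \<tau>) \<longlonglongrightarrow> 1"
proof -
  have N: "filterlim (\<lambda>n. real (Suc n)) at_top sequentially"
    by (rule filterlim_compose[OF filterlim_real_sequentially filterlim_Suc])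
  have "(\<lambda>n. flat_exp 0 (real (Suc n) * c - 1)) \<longlonglongrightarrow> 1" if "c > 0" for c
  proof (rule filterlim_compose[OF flat_exp_0_tendsto_1])
    have "filterlim (\<lambda>n. - 1 + c * real (Suc n)) at_top sequentially"
      using that by (intro filterlim_tendsto_add_at_top[OF tendsto_const]
        filterlim_tendsto_pos_mult_at_top[OF tendsto_const _ N])
    then show "filterlim (\<lambda>n. real (Suc n) * c - 1) at_top sequentially"
      by (simp add: algebra_simps)
  qed
  from tendsto_mult[OF this[of "\<tau> - a"] this[of "b - \<tau>"]] assms show ?thesis
    unfolding cutoff_def by simp
qed

section \<open>The Wasserstein distance\<close>

lemma P2_D:
  assumes "\<mu> \<in> P2"
  shows "prob_space \<mu>" and "sets \<mu> = sets borel" and "space \<mu> = UNIV"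
    and "integrable \<mu> (\<lambda>x. (norm x)\<^sup>2)"
  using assms sets_eq_imp_space_eq[of \<mu> borel] by (auto simp: P2_def)

lemma couplings_D:
  assumes "\<gamma> \<in> couplings \<mu> \<nu>"
  shows "prob_space \<gamma>" and "sets \<gamma> = sets borel" and "space \<gamma> = UNIV"
    and "distr \<gamma> borel fst = \<mu>" and "distr \<gamma> borel snd = \<nu>"
  using assms sets_eq_imp_space_eq[of \<gamma> borel] by (auto simp: couplings_def)

lemma couplings_nonempty:
  fixes \<mu> \<nu> :: "'a::euclidean_space measure"
  assumes "\<mu> \<in> P2" "\<nu> \<in> P2"
  shows "couplings \<mu> \<nu> \<noteq> {}"
proof -
  interpret \<mu>: prob_space \<mu> using P2_D[OF assms(1)] by simp
  interpret \<nu>: prob_space \<nu> using P2_D[OF assms(2)] by simp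
  interpret pair_prob_space \<mu> \<nu> ..
  have [measurable_cong]: "sets \<mu> = sets borel" "sets \<nu> = sets borel"
    using P2_D assms by auto
  have s: "space \<mu> = UNIV" "space \<nu> = UNIV"
    by (rule P2_D(3)[OF assms(1)] P2_D(3)[OF assms(2)])+
  have "\<mu> \<Otimes>\<^sub>M \<nu> \<in> couplings \<mu> \<nu>"
    unfolding couplings_def
  proof (intro CollectI conjI)
    show "prob_space (\<mu> \<Otimes>\<^sub>M \<nu>)"
      by (rule prob_space_axioms)
    have "sets (\<mu> \<Otimes>\<^sub>M \<nu>) = sets (borel \<Otimes>\<^sub>M borel)"
      by (intro sets_pair_measure_cong) fact+
    then show "sets (\<mu> \<Otimes>\<^sub>M \<nu>) = sets borel"
      by (simp only: borel_prod)
    show "distr (\<mu> \<Otimes>\<^sub>M \<nu>) borel fst = \<mu>"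
    proof (rule measure_eqI)
      fix A assume "A \<in> sets (distr (\<mu> \<Otimes>\<^sub>M \<nu>) borel fst)"
      then have [measurable]: "A \<in> sets borel" by simp
      have "fst -` A \<inter> space (\<mu> \<Otimes>\<^sub>M \<nu>) = A \<times> space \<nu>"
        by (auto simp: space_pair_measure s)
      then show "emeasure (distr (\<mu> \<Otimes>\<^sub>M \<nu>) borel fst) A = emeasure \<mu> A"
        by (simp add: emeasure_distr \<nu>.emeasure_pair_measure_Times \<nu>.emeasure_space_1[unfolded s] P2_D[OF assms(1)] P2_D[OF assms(2)])
    qed (simp add: P2_D assms)
    show "distr (\<mu> \<Otimes>\<^sub>M \<nu>) borel snd = \<nu>"
    proof (rule measure_eqI)
      fix A assume "A \<in> sets (distr (\<mu> \<Otimes>\<^sub>M \<nu>) borel snd)"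
      then have [measurable]: "A \<in> sets borel" by simp
      have "snd -` A \<inter> space (\<mu> \<Otimes>\<^sub>M \<nu>) = space \<mu> \<times> A"
        by (auto simp: space_pair_measure s)
      then show "emeasure (distr (\<mu> \<Otimes>\<^sub>M \<nu>) borel snd) A = emeasure \<nu> A"
        by (simp add: emeasure_distr \<nu>.emeasure_pair_measure_Times \<mu>.emeasure_space_1[unfolded s] P2_D[OF assms(1)] P2_D[OF assms(2)])
    qed (simp add: P2_D assms)
  qed
  then show ?thesis by auto
qed

lemma integrable_coupling_iff:
  fixes f :: "'a::euclidean_space \<Rightarrow> real"
  assumes "\<gamma> \<in> couplings \<mu> \<nu>" and [measurable]: "f \<in> borel_measurable borel"
  shows "integrable \<gamma> (\<lambda>z. f (fst z)) \<longleftrightarrow> integrable \<mu> f"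
    and "integrable \<gamma> (\<lambda>z. f (snd z)) \<longleftrightarrow> integrable \<nu> f"
    and "(\<integral>z. f (fst z) \<partial>\<gamma>) = (\<integral>x. f x \<partial>\<mu>)"
    and "(\<integral>z. f (snd z) \<partial>\<gamma>) = (\<integral>x. f x \<partial>\<nu>)"
proof -
  have [measurable_cong]: "sets \<gamma> = sets (borel \<Otimes>\<^sub>M borel)"
    using couplings_D(2)[OF assms(1)] by (simp only: borel_prod)
  show "integrable \<gamma> (\<lambda>z. f (fst z)) \<longleftrightarrow> integrable \<mu> f"
    "(\<integral>z. f (fst z) \<partial>\<gamma>) = (\<integral>x. f x \<partial>\<mu>)"
    unfolding couplings_D(4)[OF assms(1), symmetric]
    by (simp_all add: integrable_distr_eq integral_distr)
  show "integrable \<gamma> (\<lambda>z. f (snd z)) \<longleftrightarrow> integrable \<nu> f"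
    "(\<integral>z. f (snd z) \<partial>\<gamma>) = (\<integral>x. f x \<partial>\<nu>)"
    unfolding couplings_D(5)[OF assms(1), symmetric]
    by (simp_all add: integrable_distr_eq integral_distr)
qed

lemma integrable_transport_cost:
  fixes \<mu> \<nu> :: "'a::euclidean_space measure"
  assumes "\<mu> \<in> P2" "\<nu> \<in> P2" "\<gamma> \<in> couplings \<mu> \<nu>"
  shows "integrable \<gamma> (\<lambda>z. (dist (fst z) (snd z))\<^sup>2)"
proof (rule Bochner_Integration.integrable_bound)
  have [measurable_cong]: "sets \<gamma> = sets (borel \<Otimes>\<^sub>M borel)"
    using couplings_D(2)[OF assms(3)] by (simp only: borel_prod)
  show "(\<lambda>z. (dist (fst z) (snd z))\<^sup>2) \<in> borel_measurable \<gamma>"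
    by measurable
  show "integrable \<gamma> (\<lambda>z. 2 * (norm (fst z))\<^sup>2 + 2 * (norm (snd z))\<^sup>2)"
    using integrable_coupling_iff(1,2)[OF assms(3), of "\<lambda>x. (norm x)\<^sup>2"] P2_D(4) assms by auto
  have "(dist x y)\<^sup>2 \<le> 2 * (norm x)\<^sup>2 + 2 * (norm y)\<^sup>2" for x y :: 'a
  proof -
    have "(dist x y)\<^sup>2 \<le> (norm x + norm y)\<^sup>2"
      by (intro power_mono) (auto simp: dist_norm norm_triangle_ineq4)
    also have "\<dots> \<le> 2 * (norm x)\<^sup>2 + 2 * (norm y)\<^sup>2"
      using zero_le_power2[of "norm x - norm y"] by (simp add: power2_eq_square algebra_simps)
    finally show ?thesis .
  qed
  then show "AE z in \<gamma>. norm ((dist (fst z) (snd z))\<^sup>2) \<le> norm (2 * (norm (fst z))\<^sup>2 + 2 * (norm (snd z))\<^sup>2)"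
    by (auto intro!: AE_I2)
qed

lemma W2_le_sqrt_cost:
  fixes \<mu> \<nu> :: "'a::euclidean_space measure"
  assumes "\<gamma> \<in> couplings \<mu> \<nu>"
  shows "W2 \<mu> \<nu> \<le> sqrt (\<integral>z. (dist (fst z) (snd z))\<^sup>2 \<partial>\<gamma>)"
  unfolding W2_def
  by (intro real_sqrt_le_mono cINF_lower[OF _ assms] bdd_belowI2[of _ 0] integral_nonneg) simp

lemma W2_nonneg:
  fixes \<mu> \<nu> :: "'a::euclidean_space measure"
  assumes "\<mu> \<in> P2" "\<nu> \<in> P2"
  shows "0 \<le> W2 \<mu> \<nu>"
  unfolding W2_def using couplings_nonempty[OF assms]
  by (intro real_sqrt_ge_zero cINF_greatest integral_nonneg) auto

lemma W2_less_obtain_coupling: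
  fixes \<mu> \<nu> :: "'a::euclidean_space measure"
  assumes "\<mu> \<in> P2" "\<nu> \<in> P2" "W2 \<mu> \<nu> < p"
  obtains \<gamma> where "\<gamma> \<in> couplings \<mu> \<nu>" "(\<integral>z. (dist (fst z) (snd z))\<^sup>2 \<partial>\<gamma>) < p\<^sup>2"
proof -
  have "0 \<le> p"
    using W2_nonneg[OF assms(1,2)] assms(3) by simp
  then have "(INF \<gamma>\<in>couplings \<mu> \<nu>. \<integral>z. (dist (fst z) (snd z))\<^sup>2 \<partial>\<gamma>) < p\<^sup>2"
    using assms(3) real_less_lsqrt real_sqrt_less_iff[of _ "p\<^sup>2"] unfolding W2_def by simp
  then show thesis
    using that couplings_nonempty[OF assms(1,2)]
    by (subst (asm) cINF_less_iff) (auto intro!: bdd_belowI2[of _ 0] integral_nonneg)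
qed

text \<open>The easy half of Kantorovich duality: along any coupling the difference of the integrals is at
  most \<open>L\<close> times the expected distance, which by Jensen is at most the root of the quadratic
  cost.\<close>
lemma integral_diff_le_W2:
  fixes \<mu> \<nu> :: "'a::euclidean_space measure" and f :: "'a \<Rightarrow> real"
  assumes P: "\<mu> \<in> P2" "\<nu> \<in> P2" and f: "integrable \<mu> f" "integrable \<nu> f"
    and L: "0 \<le> L" "\<And>x y. \<bar>f x - f y\<bar> \<le> L * dist x y"
  shows "\<bar>(\<integral>x. f x \<partial>\<mu>) - (\<integral>x. f x \<partial>\<nu>)\<bar> \<le> L * W2 \<mu> \<nu>"
proof -
  have [measurable]: "f \<in> borel_measurable borel"
    using borel_measurable_integrable[OF f(1)] P2_D(2)[OF P(1)] by (simp cong: measurable_cong_sets)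
  have "\<bar>(\<integral>x. f x \<partial>\<mu>) - (\<integral>x. f x \<partial>\<nu>)\<bar> \<le> L * p" if "W2 \<mu> \<nu> < p" for p
  proof -
    obtain \<gamma> where \<gamma>: "\<gamma> \<in> couplings \<mu> \<nu>" "(\<integral>z. (dist (fst z) (snd z))\<^sup>2 \<partial>\<gamma>) < p\<^sup>2"
      using W2_less_obtain_coupling[OF P \<open>W2 \<mu> \<nu> < p\<close>] .
    interpret prob_space \<gamma> using couplings_D(1)[OF \<gamma>(1)] .
    have [measurable_cong]: "sets \<gamma> = sets (borel \<Otimes>\<^sub>M borel)"
      using couplings_D(2)[OF \<gamma>(1)] by (simp only: borel_prod)
    let ?d = "\<lambda>z::'a \<times> 'a. dist (fst z) (snd z)"
    have sq: "integrable \<gamma> (\<lambda>z. (?d z)\<^sup>2)"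
      by (rule integrable_transport_cost[OF P \<gamma>(1)])
    have d: "integrable \<gamma> ?d"
      by (rule square_integrable_imp_integrable[OF _ sq]) measurable
    have "0 \<le> variance ?d"
      by (rule variance_positive)
    then have "(expectation ?d)\<^sup>2 < p\<^sup>2"
      using \<gamma>(2) variance_eq[OF d sq] by simp
    then have dp: "expectation ?d \<le> p"
      using power2_less_imp_less[of "expectation ?d" p] that W2_nonneg[OF P] by linarith
    have i: "integrable \<gamma> (\<lambda>z. f (fst z))" "integrable \<gamma> (\<lambda>z. f (snd z))"
      using f integrable_coupling_iff[OF \<gamma>(1), of f] by auto
    have "\<bar>(\<integral>x. f x \<partial>\<mu>) - (\<integral>x. f x \<partial>\<nu>)\<bar> = \<bar>\<integral>z. f (fst z) - f (snd z) \<partial>\<gamma>\<bar>"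
      using i integrable_coupling_iff(3,4)[OF \<gamma>(1), of f] by simp
    also have "\<dots> \<le> (\<integral>z. \<bar>f (fst z) - f (snd z)\<bar> \<partial>\<gamma>)"
      by (rule integral_abs_bound)
    also have "\<dots> \<le> (\<integral>z. L * ?d z \<partial>\<gamma>)"
      using i d by (intro integral_mono L) auto
    also have "\<dots> \<le> L * p"
      using dp L by (simp add: mult_left_mono)
    finally show ?thesis .
  qed
  then have *: "\<bar>(\<integral>x. f x \<partial>\<mu>) - (\<integral>x. f x \<partial>\<nu>)\<bar> \<le> L * (W2 \<mu> \<nu> + e)" if "e > 0" for e
    using that by simp
  have "((\<lambda>e. L * (W2 \<mu> \<nu> + e)) \<longlongrightarrow> L * (W2 \<mu> \<nu> + 0)) (at_right 0)"
    by (intro tendsto_intros)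
  then have "\<bar>(\<integral>x. f x \<partial>\<mu>) - (\<integral>x. f x \<partial>\<nu>)\<bar> \<le> L * (W2 \<mu> \<nu> + 0)"
    by (rule tendsto_lowerbound)
      (use * in \<open>auto simp: eventually_at_right_field intro!: exI[of _ 1]\<close>)
  then show ?thesis by simp
qed

text \<open>A measurable partition into countably many cells of diameter at most \<open>r\<close>, encoded by the index of
  the first point of a dense sequence within \<open>r/2\<close>.\<close>
lemma ex_small_cells:
  fixes r :: real
  assumes "0 < r"
  shows "\<exists>cell :: 'a::euclidean_space \<Rightarrow> nat. cell \<in> borel \<rightarrow>\<^sub>M count_space UNIV \<and>
    (\<forall>y y'. cell y = cell y' \<longrightarrow> dist y y' \<le> r)"
proof -
  obtain D :: "'a set" where D: "countable D" "\<And>X. open X \<Longrightarrow> X \<noteq> {} \<Longrightarrow> \<exists>d\<in>D. d \<in> X"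
    using countable_dense_exists by blast
  define d where "d = from_nat_into D"
  define cell where "cell y = (LEAST n. dist y (d n) < r / 2)" for y
  have near: "dist y (d (cell y)) < r / 2" for y
  proof -
    obtain z where "z \<in> D" "z \<in> ball y (r / 2)"
      using D(2)[of "ball y (r / 2)"] assms by auto
    moreover then obtain n where "z = d n"
      using D(1) by (metis d_def from_nat_into_surj)
    ultimately have "dist y (d n) < r / 2" by simp
    then show ?thesis
      unfolding cell_def by (rule LeastI)
  qed
  show ?thesis
  proof (intro exI conjI allI impI)
    show "cell \<in> borel \<rightarrow>\<^sub>M count_space UNIV"
      unfolding cell_def by measurable
    fix y y' assume "cell y = cell y'"
    then show "dist y y' \<le> r"
      using near[of y] near[of y'] dist_triangle2[of y y' "d (cell y)"] by simp
  qed
qed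

text \<open>The gluing lemma produces a measure whose marginals are two couplings with a common middle
  marginal \<open>\<nu>\<close>, and for which the two middle points coincide. The exact statement requires
  disintegration; if the middle points may differ by \<open>r\<close>, an explicit density suffices. On the
  product \<open>\<gamma>1 \<Otimes> \<gamma>2\<close> the density is \<open>1 / \<nu> (cell)\<close> where both middle points lie in the same cell
  and \<open>0\<close> elsewhere. Integrating out one factor gives \<open>\<nu> (cell) / \<nu> (cell) = 1\<close>, so the marginals
  are unchanged.\<close>
lemma approximate_gluing:
  fixes \<mu> \<nu> \<sigma> :: "'a::euclidean_space measure"
  assumes \<nu>: "\<nu> \<in> P2" and \<gamma>1: "\<gamma>1 \<in> couplings \<mu> \<nu>" and \<gamma>2: "\<gamma>2 \<in> couplings \<nu> \<sigma>" and r: "0 < r"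
  obtains \<pi> where "prob_space \<pi>" "sets \<pi> = sets borel"
    "distr \<pi> borel fst = \<gamma>1" "distr \<pi> borel snd = \<gamma>2"
    "AE w in \<pi>. dist (snd (fst w)) (fst (snd w)) \<le> r"
proof -
  obtain cell :: "'a \<Rightarrow> nat" where cell[measurable]: "cell \<in> borel \<rightarrow>\<^sub>M count_space UNIV"
    and close: "\<And>y y'. cell y = cell y' \<Longrightarrow> dist y y' \<le> r"
    using ex_small_cells[OF r] by blast
  interpret \<nu>: prob_space \<nu> using P2_D[OF \<nu>] by simp
  interpret \<gamma>1: prob_space \<gamma>1 using couplings_D[OF \<gamma>1] by simp
  interpret \<gamma>2: prob_space \<gamma>2 using couplings_D[OF \<gamma>2] by simp
  interpret pair_prob_space \<gamma>1 \<gamma>2 ..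
  have [measurable_cong]: "sets \<nu> = sets borel"
    "sets \<gamma>1 = sets (borel \<Otimes>\<^sub>M borel)" "sets \<gamma>2 = sets (borel \<Otimes>\<^sub>M borel)"
    using P2_D(2)[OF \<nu>] couplings_D(2)[OF \<gamma>1] couplings_D(2)[OF \<gamma>2] by (simp_all only: borel_prod)
  have sp: "space \<gamma>1 = UNIV" "space \<gamma>2 = UNIV" "space \<nu> = UNIV"
    using couplings_D(3)[OF \<gamma>1] couplings_D(3)[OF \<gamma>2] P2_D(3)[OF \<nu>] .
  define mass where "mass k = emeasure \<nu> (cell -` {k})" for k
  define wt where "wt y = inverse (mass (cell y))" for y
  have [measurable]: "wt \<in> borel_measurable borel"
    unfolding wt_def by (rule measurable_compose[OF cell]) simp
  define h where "h w = (if cell (snd (fst w)) = cell (fst (snd w)) then wt (snd (fst w)) else 0)"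
    for w :: "('a \<times> 'a) \<times> ('a \<times> 'a)"
  have h[measurable]: "h \<in> borel_measurable (\<gamma>1 \<Otimes>\<^sub>M \<gamma>2)"
  proof -
    have "Measurable.pred (\<gamma>1 \<Otimes>\<^sub>M \<gamma>2) (\<lambda>w. \<exists>k. cell (snd (fst w)) = k \<and> cell (fst (snd w)) = k)"
      by measurable
    then have [measurable]: "Measurable.pred (\<gamma>1 \<Otimes>\<^sub>M \<gamma>2) (\<lambda>w. cell (snd (fst w)) = cell (fst (snd w)))"
      by (simp add: eq_commute)
    show ?thesis
      unfolding h_def by measurable
  qed
  have mass_fin: "mass k \<noteq> \<infinity>" for k
    unfolding mass_def by simp
  have mass1: "emeasure \<gamma>1 {z. cell (snd z) = k} = mass k" for k
    unfolding mass_def by (subst couplings_D(5)[OF \<gamma>1, symmetric], subst emeasure_distr)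
      (auto simp: sp vimage_def)
  have mass2: "emeasure \<gamma>2 {z. cell (fst z) = k} = mass k" for k
    unfolding mass_def by (subst couplings_D(4)[OF \<gamma>2, symmetric], subst emeasure_distr)
      (auto simp: sp vimage_def)
  \<comment> \<open>The marginal computation divides by the mass of the cell, so the countably many null cells
    must be discarded.\<close>
  have mass_pos: "AE y in \<nu>. mass (cell y) \<noteq> 0"
  proof -
    have "AE y in \<nu>. mass k = 0 \<longrightarrow> cell y \<noteq> k" for k
    proof (cases "mass k = 0")
      case True
      then have "cell -` {k} \<in> null_sets \<nu>"
        using measurable_sets[OF cell, of "{k}"] P2_D(2)[OF \<nu>] by (auto simp: null_sets_def mass_def)
      then have "AE y in \<nu>. y \<notin> cell -` {k}"
        by (rule AE_not_in)
      then show ?thesis by auto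
    qed simp
    then have "AE y in \<nu>. \<forall>k. mass k = 0 \<longrightarrow> cell y \<noteq> k"
      by (simp add: AE_all_countable)
    then show ?thesis by eventually_elim auto
  qed
  have pos1: "AE z in \<gamma>1. mass (cell (snd z)) \<noteq> 0"
    by (rule AE_distrD[where f = snd and M' = borel]) (simp, simp only: couplings_D(5)[OF \<gamma>1] mass_pos)
  have pos2: "AE z in \<gamma>2. mass (cell (fst z)) \<noteq> 0"
    by (rule AE_distrD[where f = fst and M' = borel]) (simp, simp only: couplings_D(4)[OF \<gamma>2] mass_pos)
  have ev1: "{z. cell (snd z) = k} \<in> sets \<gamma>1" for k
  proof -
    have "{z \<in> space \<gamma>1. cell (snd z) = k} \<in> sets \<gamma>1" by measurable
    then show ?thesis by (simp add: sp)
  qed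
  have ev2: "{z. cell (fst z) = k} \<in> sets \<gamma>2" for k
  proof -
    have "{z \<in> space \<gamma>2. cell (fst z) = k} \<in> sets \<gamma>2" by measurable
    then show ?thesis by (simp add: sp)
  qed
  have inv: "inverse (mass k) * mass k = 1" if "mass k \<noteq> 0" for k
    using that mass_fin[of k] ennreal_divide_self[of "mass k"]
    by (simp add: divide_ennreal_def mult.commute less_top)
  have h1: "AE z in \<gamma>1. (\<integral>\<^sup>+z'. h (z, z') \<partial>\<gamma>2) = 1"
    using pos1
  proof eventually_elim
    fix z :: "'a \<times> 'a" assume z: "mass (cell (snd z)) \<noteq> 0"
    have "(\<integral>\<^sup>+z'. h (z, z') \<partial>\<gamma>2) =
        (\<integral>\<^sup>+z'. inverse (mass (cell (snd z))) * indicator {z'. cell (fst z') = cell (snd z)} z' \<partial>\<gamma>2)"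
      by (intro nn_integral_cong) (auto simp: h_def wt_def indicator_def)
    also have "\<dots> = inverse (mass (cell (snd z))) * mass (cell (snd z))"
      unfolding mass2[symmetric] by (intro nn_integral_cmult_indicator ev2)
    finally show "(\<integral>\<^sup>+z'. h (z, z') \<partial>\<gamma>2) = 1"
      using inv[OF z] by simp
  qed
  have h2: "AE z' in \<gamma>2. (\<integral>\<^sup>+z. h (z, z') \<partial>\<gamma>1) = 1"
    using pos2
  proof eventually_elim
    fix z' :: "'a \<times> 'a" assume z': "mass (cell (fst z')) \<noteq> 0"
    have "(\<integral>\<^sup>+z. h (z, z') \<partial>\<gamma>1) =
        (\<integral>\<^sup>+z. inverse (mass (cell (fst z'))) * indicator {z. cell (snd z) = cell (fst z')} z \<partial>\<gamma>1)"
      by (intro nn_integral_cong) (auto simp: h_def wt_def indicator_def)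
    also have "\<dots> = inverse (mass (cell (fst z'))) * mass (cell (fst z'))"
      unfolding mass1[symmetric] by (intro nn_integral_cmult_indicator ev1)
    finally show "(\<integral>\<^sup>+z. h (z, z') \<partial>\<gamma>1) = 1"
      using inv[OF z'] by simp
  qed
  define \<pi> where "\<pi> = density (\<gamma>1 \<Otimes>\<^sub>M \<gamma>2) h"
  have sets_pi: "sets \<pi> = sets borel"
  proof -
    have "sets (\<gamma>1 \<Otimes>\<^sub>M \<gamma>2) = sets ((borel \<Otimes>\<^sub>M borel) \<Otimes>\<^sub>M (borel \<Otimes>\<^sub>M borel))"
      by (intro sets_pair_measure_cong) fact+
    then show ?thesis
      by (simp only: \<pi>_def borel_prod sets_density)
  qed
  have fst_pi: "distr \<pi> borel fst = \<gamma>1"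
  proof (rule measure_eqI)
    fix A :: "('a \<times> 'a) set" assume "A \<in> sets (distr \<pi> borel fst)"
    then have A: "A \<in> sets borel" by simp
    then have [measurable]: "A \<in> sets (borel \<Otimes>\<^sub>M borel)" by (simp only: borel_prod)
    have A1: "A \<in> sets \<gamma>1" using A couplings_D(2)[OF \<gamma>1] by simp
    have "emeasure (distr \<pi> borel fst) A = emeasure \<pi> (fst -` A)"
      using A by (subst emeasure_distr) (auto simp: \<pi>_def space_pair_measure sp borel_prod[symmetric])
    also have "\<dots> = (\<integral>\<^sup>+w. h w * indicator (fst -` A) w \<partial>(\<gamma>1 \<Otimes>\<^sub>M \<gamma>2))"
    proof -
      have "fst -` A \<in> sets (\<gamma>1 \<Otimes>\<^sub>M \<gamma>2)"
        using measurable_sets[OF measurable_fst A1, of \<gamma>2] by (simp add: space_pair_measure sp)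
      then show ?thesis unfolding \<pi>_def by (intro emeasure_density) auto
    qed
    also have "\<dots> = (\<integral>\<^sup>+w. h w * indicator A (fst w) \<partial>(\<gamma>1 \<Otimes>\<^sub>M \<gamma>2))"
      by (intro nn_integral_cong) (auto simp: indicator_def)
    also have "\<dots> = (\<integral>\<^sup>+z. \<integral>\<^sup>+z'. h (z, z') * indicator A z \<partial>\<gamma>2 \<partial>\<gamma>1)"
      by (subst \<gamma>2.nn_integral_fst[symmetric]) (auto simp: A1)
    also have "\<dots> = (\<integral>\<^sup>+z. (\<integral>\<^sup>+z'. h (z, z') \<partial>\<gamma>2) * indicator A z \<partial>\<gamma>1)"
      by (intro nn_integral_cong nn_integral_multc) (simp add: sp)
    also have "\<dots> = (\<integral>\<^sup>+z. indicator A z \<partial>\<gamma>1)"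
      by (intro nn_integral_cong_AE) (use h1 in \<open>eventually_elim, simp\<close>)
    also have "\<dots> = emeasure \<gamma>1 A"
      using A1 by simp
    finally show "emeasure (distr \<pi> borel fst) A = emeasure \<gamma>1 A" .
  qed (simp add: couplings_D(2)[OF \<gamma>1])
  have snd_pi: "distr \<pi> borel snd = \<gamma>2"
  proof (rule measure_eqI)
    fix A :: "('a \<times> 'a) set" assume "A \<in> sets (distr \<pi> borel snd)"
    then have A: "A \<in> sets borel" by simp
    then have [measurable]: "A \<in> sets (borel \<Otimes>\<^sub>M borel)" by (simp only: borel_prod)
    have A2: "A \<in> sets \<gamma>2" using A couplings_D(2)[OF \<gamma>2] by simp
    have "emeasure (distr \<pi> borel snd) A = emeasure \<pi> (snd -` A)"
      using A by (subst emeasure_distr) (auto simp: \<pi>_def space_pair_measure sp borel_prod[symmetric])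
    also have "\<dots> = (\<integral>\<^sup>+w. h w * indicator (snd -` A) w \<partial>(\<gamma>1 \<Otimes>\<^sub>M \<gamma>2))"
    proof -
      have "snd -` A \<in> sets (\<gamma>1 \<Otimes>\<^sub>M \<gamma>2)"
        using measurable_sets[OF measurable_snd A2, of \<gamma>1] by (simp add: space_pair_measure sp)
      then show ?thesis unfolding \<pi>_def by (intro emeasure_density) auto
    qed
    also have "\<dots> = (\<integral>\<^sup>+w. h w * indicator A (snd w) \<partial>(\<gamma>1 \<Otimes>\<^sub>M \<gamma>2))"
      by (intro nn_integral_cong) (auto simp: indicator_def)
    also have "\<dots> = (\<integral>\<^sup>+z'. \<integral>\<^sup>+z. h (z, z') * indicator A z' \<partial>\<gamma>1 \<partial>\<gamma>2)"
      by (subst nn_integral_snd[symmetric]) (auto simp: A2)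
    also have "\<dots> = (\<integral>\<^sup>+z'. (\<integral>\<^sup>+z. h (z, z') \<partial>\<gamma>1) * indicator A z' \<partial>\<gamma>2)"
      by (intro nn_integral_cong nn_integral_multc) (simp add: sp)
    also have "\<dots> = (\<integral>\<^sup>+z'. indicator A z' \<partial>\<gamma>2)"
      by (intro nn_integral_cong_AE) (use h2 in \<open>eventually_elim, simp\<close>)
    also have "\<dots> = emeasure \<gamma>2 A"
      using A2 by simp
    finally show "emeasure (distr \<pi> borel snd) A = emeasure \<gamma>2 A" .
  qed (simp add: couplings_D(2)[OF \<gamma>2])
  have "AE w in \<pi>. dist (snd (fst w)) (fst (snd w)) \<le> r"
    unfolding \<pi>_def by (subst AE_density[OF h]) (auto simp: h_def close)
  moreover have "prob_space \<pi>"
  proof (rule prob_space_distrD)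
    show "fst \<in> measurable \<pi> borel"
      using measurable_fst[of \<gamma>1 \<gamma>2] couplings_D(2)[OF \<gamma>1]
      by (simp add: \<pi>_def measurable_def sets_eq_imp_space_eq[of \<gamma>1 borel])
    show "prob_space (distr \<pi> borel fst)"
      unfolding fst_pi by (rule \<gamma>1.prob_space_axioms)
  qed
  ultimately show thesis
    using sets_pi fst_pi snd_pi that by blast
qed

text \<open>Cauchy's inequality in the form that avoids Minkowski's inequality in \<open>L\<^sup>2\<close>: with \<open>p\<close>, \<open>q\<close>,
  \<open>r\<close> bounding the \<open>L\<^sup>2\<close> norms of \<open>A\<close>, \<open>B\<close>, \<open>C\<close>, integrating the right-hand side gives at most
  \<open>(p + q + r)\<^sup>2\<close>.\<close>
lemma weighted_square_of_sum:
  fixes A B C p q r :: real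
  assumes "0 < p" "0 < q" "0 < r"
  shows "(A + B + C)\<^sup>2 \<le> (p + q + r) * (A\<^sup>2 / p + B\<^sup>2 / q + C\<^sup>2 / r)"
proof -
  have two: "(A + B)\<^sup>2 \<le> (p + q) * (A\<^sup>2 / p + B\<^sup>2 / q)" if "0 < p" "0 < q" for A B p q :: real
  proof -
    have "(p + q) * (A\<^sup>2 / p + B\<^sup>2 / q) - (A + B)\<^sup>2 = (q * A - p * B)\<^sup>2 / (p * q)"
      using that by (simp add: field_simps power2_eq_square)
    moreover have "0 \<le> (q * A - p * B)\<^sup>2 / (p * q)"
      using that by simp
    ultimately show ?thesis by linarith
  qed
  have "(A + B + C)\<^sup>2 \<le> (p + q + r) * ((A + B)\<^sup>2 / (p + q) + C\<^sup>2 / r)"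
    using two[of "p + q" r "A + B" C] assms by simp
  also have "\<dots> \<le> (p + q + r) * ((A\<^sup>2 / p + B\<^sup>2 / q) + C\<^sup>2 / r)"
    using two[of p q A B] assms
    by (intro mult_left_mono add_right_mono) (auto simp: divide_le_eq mult.commute)
  finally show ?thesis .
qed

text \<open>Nearly optimal couplings of \<open>\<mu>, \<nu>\<close> and of \<open>\<nu>, \<sigma>\<close> are glued up to an error \<open>r\<close> in the middle
  points; the two outer points then form a coupling of \<open>\<mu>, \<sigma>\<close> whose cost is at most
  \<open>(p + q + r)\<^sup>2\<close>, where \<open>p\<close> and \<open>q\<close> exceed the two distances by \<open>r\<close>.\<close>
lemma W2_triangle:
  fixes \<mu> \<nu> \<sigma> :: "'a::euclidean_space measure"
  assumes P: "\<mu> \<in> P2" "\<nu> \<in> P2" "\<sigma> \<in> P2"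
  shows "W2 \<mu> \<sigma> \<le> W2 \<mu> \<nu> + W2 \<nu> \<sigma>"
proof -
  have "W2 \<mu> \<sigma> \<le> (W2 \<mu> \<nu> + r) + (W2 \<nu> \<sigma> + r) + r" if r: "r > 0" for r
  proof -
    define p where "p = W2 \<mu> \<nu> + r"
    define q where "q = W2 \<nu> \<sigma> + r"
    have pq: "0 < p" "0 < q"
      using W2_nonneg[OF P(1,2)] W2_nonneg[OF P(2,3)] r by (auto simp: p_def q_def)
    obtain \<gamma>1 where \<gamma>1: "\<gamma>1 \<in> couplings \<mu> \<nu>" "(\<integral>z. (dist (fst z) (snd z))\<^sup>2 \<partial>\<gamma>1) < p\<^sup>2"
      using W2_less_obtain_coupling[OF P(1,2), of p] r by (auto simp: p_def)
    obtain \<gamma>2 where \<gamma>2: "\<gamma>2 \<in> couplings \<nu> \<sigma>" "(\<integral>z. (dist (fst z) (snd z))\<^sup>2 \<partial>\<gamma>2) < q\<^sup>2"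
      using W2_less_obtain_coupling[OF P(2,3), of q] r by (auto simp: q_def)
    obtain \<pi> where \<pi>: "prob_space \<pi>" "sets \<pi> = sets borel"
      "distr \<pi> borel fst = \<gamma>1" "distr \<pi> borel snd = \<gamma>2"
      "AE w in \<pi>. dist (snd (fst w)) (fst (snd w)) \<le> r"
      using approximate_gluing[OF P(2) \<gamma>1(1) \<gamma>2(1) r] .
    interpret prob_space \<pi> by fact
    have [measurable_cong]: "sets \<pi> = sets ((borel \<Otimes>\<^sub>M borel) \<Otimes>\<^sub>M (borel \<Otimes>\<^sub>M borel))"
      using \<pi>(2) by (simp only: borel_prod)
    have [measurable]: "fst \<in> \<pi> \<rightarrow>\<^sub>M borel" "snd \<in> \<pi> \<rightarrow>\<^sub>M borel"
      unfolding borel_prod[symmetric] by measurable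
    define \<delta> where "\<delta> = distr \<pi> borel (\<lambda>w. (fst (fst w), snd (snd w)))"
    have ends[measurable]: "(\<lambda>w. (fst (fst w), snd (snd w))) \<in> \<pi> \<rightarrow>\<^sub>M borel"
      unfolding borel_prod[symmetric] by measurable
    have [measurable]: "(fst :: 'a \<times> 'a \<Rightarrow> 'a) \<in> borel \<rightarrow>\<^sub>M borel" "(snd :: 'a \<times> 'a \<Rightarrow> 'a) \<in> borel \<rightarrow>\<^sub>M borel"
      unfolding borel_prod[symmetric] by simp_all
    have "\<delta> \<in> couplings \<mu> \<sigma>"
    proof -
      have "distr \<delta> borel fst = distr (distr \<pi> borel fst) borel fst"
        unfolding \<delta>_def by (simp add: distr_distr comp_def)
      moreover have "distr \<delta> borel snd = distr (distr \<pi> borel snd) borel snd"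
        unfolding \<delta>_def by (simp add: distr_distr comp_def)
      ultimately show ?thesis
        using couplings_D(4)[OF \<gamma>1(1)] couplings_D(5)[OF \<gamma>2(1)] prob_space_distr[OF ends]
        by (auto simp: couplings_def \<pi> \<delta>_def)
    qed
    then have "W2 \<mu> \<sigma> \<le> sqrt (\<integral>z. (dist (fst z) (snd z))\<^sup>2 \<partial>\<delta>)"
      by (rule W2_le_sqrt_cost)
    also have "(\<integral>z. (dist (fst z) (snd z))\<^sup>2 \<partial>\<delta>) = (\<integral>w. (dist (fst (fst w)) (snd (snd w)))\<^sup>2 \<partial>\<pi>)"
      unfolding \<delta>_def by (subst integral_distr[OF ends]) auto
    also have "sqrt \<dots> \<le> sqrt ((p + q + r)\<^sup>2)"
    proof (rule real_sqrt_le_mono)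
      let ?a = "\<lambda>w. (dist (fst (fst w)) (snd (fst w)))\<^sup>2" and ?b = "\<lambda>w. (dist (fst (snd w)) (snd (snd w)))\<^sup>2"
      have ia: "integrable \<pi> ?a" "(\<integral>w. ?a w \<partial>\<pi>) < p\<^sup>2"
        using \<gamma>1(2) integrable_transport_cost[OF P(1,2) \<gamma>1(1)]
        unfolding \<pi>(3)[symmetric] by (auto simp: integral_distr integrable_distr_eq)
      have ib: "integrable \<pi> ?b" "(\<integral>w. ?b w \<partial>\<pi>) < q\<^sup>2"
        using \<gamma>2(2) integrable_transport_cost[OF P(2,3) \<gamma>2(1)]
        unfolding \<pi>(4)[symmetric] by (auto simp: integral_distr integrable_distr_eq)
      have "AE w in \<pi>. (dist (fst (fst w)) (snd (snd w)))\<^sup>2 \<le> (p + q + r) * (?a w / p + ?b w / q + r)"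
        using \<pi>(5)
      proof eventually_elim
        fix w :: "('a \<times> 'a) \<times> ('a \<times> 'a)"
        obtain x y y' z where w: "w = ((x, y), (y', z))"
          by (metis surj_pair)
        assume "dist (snd (fst w)) (fst (snd w)) \<le> r"
        then have yy: "dist y y' \<le> r" by (simp add: w)
        have "dist x z \<le> dist x y + dist y' z + r"
          using dist_triangle[of x z y] dist_triangle[of y z y'] yy by linarith
        then have "(dist x z)\<^sup>2 \<le> (dist x y + dist y' z + r)\<^sup>2"
          by (intro power_mono) auto
        also have "\<dots> \<le> (p + q + r) * ((dist x y)\<^sup>2 / p + (dist y' z)\<^sup>2 / q + r\<^sup>2 / r)"
          using pq r by (intro weighted_square_of_sum)
        finally show "(dist (fst (fst w)) (snd (snd w)))\<^sup>2 \<le> (p + q + r) * (?a w / p + ?b w / q + r)"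
          using r by (simp add: w power2_eq_square)
      qed
      then have "(\<integral>w. (dist (fst (fst w)) (snd (snd w)))\<^sup>2 \<partial>\<pi>) \<le>
          (\<integral>w. (p + q + r) * (?a w / p + ?b w / q + r) \<partial>\<pi>)"
        using ia ib by (intro integral_mono_AE') (auto simp: pq r less_imp_le)
      also have "\<dots> = (p + q + r) * ((\<integral>w. ?a w \<partial>\<pi>) / p + (\<integral>w. ?b w \<partial>\<pi>) / q + r)"
        using ia ib by (simp add: prob_space)
      also have "\<dots> \<le> (p + q + r) * (p\<^sup>2 / p + q\<^sup>2 / q + r)"
        using ia ib pq r by (intro mult_left_mono add_mono divide_right_mono) auto
      also have "\<dots> = (p + q + r)\<^sup>2"
        using pq by (simp add: power2_eq_square)
      finally show "(\<integral>w. (dist (fst (fst w)) (snd (snd w)))\<^sup>2 \<partial>\<pi>) \<le> (p + q + r)\<^sup>2" .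
    qed
    also have "\<dots> = p + q + r"
      using pq r by simp
    finally show ?thesis by (simp add: p_def q_def)
  qed
  note * = this
  show ?thesis
  proof (rule field_le_epsilon)
    fix e :: real assume "e > 0"
    then show "W2 \<mu> \<sigma> \<le> W2 \<mu> \<nu> + W2 \<nu> \<sigma> + e"
      using *[of "e / 3"] by simp
  qed
qed

section \<open>Integrals along absolutely continuous curves\<close>

lemma tendsto_closed_indicator:
  fixes F :: "'a::metric_space set"
  assumes "closed F" "F \<noteq> {}"
  shows "(\<lambda>n. max 0 (1 - real n * infdist x F)) \<longlonglongrightarrow> indicator F x"
proof (cases "x \<in> F")
  case True
  then show ?thesis by simp
next
  case False
  then have pos: "0 < infdist x F"
    using assms by (metis in_closed_iff_infdist_zero infdist_nonneg less_le)
  have "\<forall>\<^sub>F n in sequentially. 1 / infdist x F \<le> real n"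
    by (rule eventually_sequentiallyI[of "nat \<lceil>1 / infdist x F\<rceil>"]) linarith
  then have "\<forall>\<^sub>F n in sequentially. max 0 (1 - real n * infdist x F) = 0"
    by eventually_elim (use pos in \<open>simp add: field_simps\<close>)
  then show ?thesis
    using False by (simp add: tendsto_eventually)
qed

text \<open>Moving along the curve from \<open>\<sigma>\<close> to \<open>\<tau>\<close> changes the integral by at most
  \<open>L (W2 (\<rho> \<sigma>) (\<rho> \<tau>) + (\<tau> - \<sigma>))\<close>, and the distance is at most the integral of the density \<open>m\<close>
  of the curve, which is continuous in its end points.\<close>
lemma continuous_on_integral_along_curve:
  fixes \<rho> :: "real \<Rightarrow> 'a::euclidean_space measure" and \<phi> :: "real \<times> 'a \<Rightarrow> real"
  assumes \<rho>: "abs_cont_curve s t \<rho>"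
    and L: "0 \<le> L" "\<And>z w. \<bar>\<phi> z - \<phi> w\<bar> \<le> L * dist z w" and B: "\<And>z. \<bar>\<phi> z\<bar> \<le> B"
  shows "continuous_on {s..t} (\<lambda>\<tau>. \<integral>x. \<phi> (\<tau>, x) \<partial>\<rho> \<tau>)"
proof -
  obtain m where P: "\<And>\<tau>. \<tau> \<in> {s..t} \<Longrightarrow> \<rho> \<tau> \<in> P2" and m: "set_integrable lborel {s..t} m"
    and W: "\<And>a b. s \<le> a \<Longrightarrow> a \<le> b \<Longrightarrow> b \<le> t \<Longrightarrow> W2 (\<rho> a) (\<rho> b) \<le> (LBINT \<tau>:{a..b}. m \<tau>)"
    using \<rho> unfolding abs_cont_curve_def by blast
  \<comment> \<open>The increments of \<open>N\<close> dominate those of the integral.\<close>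
  define N where "N \<tau> = L * (integral {s..\<tau>} m + \<tau>)" for \<tau>
  have m_on: "m integrable_on {s..t}"
    by (rule set_borel_integral_eq_integral(1)[OF m])
  have N: "continuous_on {s..t} N"
    unfolding N_def by (intro continuous_intros indefinite_integral_continuous_1 m_on)
  define G where "G \<tau> = (\<integral>x. \<phi> (\<tau>, x) \<partial>\<rho> \<tau>)" for \<tau>
  have "continuous_on UNIV \<phi>"
  proof (rule continuous_on_iff[THEN iffD2], intro ballI allI impI)
    fix z and e :: real assume e: "0 < e"
    have "dist (\<phi> w) (\<phi> z) < e" if "dist w z < e / (L + 1)" for w
    proof -
      have "dist (\<phi> w) (\<phi> z) \<le> L * dist w z"
        using L(2)[of w z] by (simp add: dist_real_def)
      also have "\<dots> \<le> (L + 1) * dist w z"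
        by (simp add: mult_right_mono)
      also have "\<dots> < e"
        using that L(1) by (simp add: field_simps)
      finally show ?thesis .
    qed
    then show "\<exists>d>0. \<forall>w\<in>UNIV. dist w z < d \<longrightarrow> dist (\<phi> w) (\<phi> z) < e"
      using e L(1) by (intro exI[of _ "e / (L + 1)"]) auto
  qed
  then have [measurable]: "(\<lambda>x. \<phi> (\<tau>, x)) \<in> borel_measurable borel" for \<tau>
    by (intro borel_measurable_continuous_onI) (auto intro!: continuous_on_compose2[of UNIV \<phi>] continuous_intros)
  have int: "integrable (\<rho> \<tau>) (\<lambda>x. \<phi> (\<sigma>, x))" if "\<tau> \<in> {s..t}" for \<sigma> \<tau>
  proof -
    interpret prob_space "\<rho> \<tau>" by (rule P2_D(1)[OF P[OF that]])
    have [measurable_cong]: "sets (\<rho> \<tau>) = sets borel" by (rule P2_D(2)[OF P[OF that]])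
    show ?thesis
      by (intro integrable_const_bound[of _ B]) (auto simp: B)
  qed
  have le: "\<bar>G \<sigma> - G \<tau>\<bar> \<le> N \<tau> - N \<sigma>" if *: "s \<le> \<sigma>" "\<sigma> \<le> \<tau>" "\<tau> \<le> t" for \<sigma> \<tau>
  proof -
    have in_st: "\<sigma> \<in> {s..t}" "\<tau> \<in> {s..t}" using * by auto
    interpret \<tau>: prob_space "\<rho> \<tau>" by (rule P2_D(1)[OF P[OF in_st(2)]])
    have "\<bar>\<phi> (\<sigma>, x) - \<phi> (\<sigma>, y)\<bar> \<le> L * dist x y" for x y
      using L(2)[of "(\<sigma>, x)" "(\<sigma>, y)"] by (simp add: dist_prod_def)
    then have 1: "\<bar>G \<sigma> - (\<integral>x. \<phi> (\<sigma>, x) \<partial>\<rho> \<tau>)\<bar> \<le> L * W2 (\<rho> \<sigma>) (\<rho> \<tau>)"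
      unfolding G_def by (intro integral_diff_le_W2 P int in_st L(1))
    have "\<bar>(\<integral>x. \<phi> (\<sigma>, x) \<partial>\<rho> \<tau>) - G \<tau>\<bar> = \<bar>\<integral>x. \<phi> (\<sigma>, x) - \<phi> (\<tau>, x) \<partial>\<rho> \<tau>\<bar>"
      unfolding G_def by (subst Bochner_Integration.integral_diff[OF int int]) (rule in_st refl)+
    also have "\<dots> \<le> (\<integral>x. \<bar>\<phi> (\<sigma>, x) - \<phi> (\<tau>, x)\<bar> \<partial>\<rho> \<tau>)"
      by (rule integral_abs_bound)
    also have "\<dots> \<le> (\<integral>x. L * (\<tau> - \<sigma>) \<partial>\<rho> \<tau>)"
    proof (intro integral_mono)
      show "\<bar>\<phi> (\<sigma>, x) - \<phi> (\<tau>, x)\<bar> \<le> L * (\<tau> - \<sigma>)" for x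
        using L(2)[of "(\<sigma>, x)" "(\<tau>, x)"] * by (simp add: dist_prod_def dist_real_def)
    qed (auto intro!: int in_st)
    also have "\<dots> = L * (\<tau> - \<sigma>)"
      by (simp add: \<tau>.prob_space)
    finally have 2: "\<bar>(\<integral>x. \<phi> (\<sigma>, x) \<partial>\<rho> \<tau>) - G \<tau>\<bar> \<le> L * (\<tau> - \<sigma>)" .
    have sub: "set_integrable lborel {\<sigma>..\<tau>} m"
      by (rule set_integrable_subset[OF m]) (use * in auto)
    have "W2 (\<rho> \<sigma>) (\<rho> \<tau>) \<le> integral {\<sigma>..\<tau>} m"
      using W[OF *] set_borel_integral_eq_integral(2)[OF sub] by simp
    also have "integral {s..\<sigma>} m + integral {\<sigma>..\<tau>} m = integral {s..\<tau>} m"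
      using * by (intro Henstock_Kurzweil_Integration.integral_combine integrable_on_subinterval[OF m_on]) auto
    then have "integral {\<sigma>..\<tau>} m = integral {s..\<tau>} m - integral {s..\<sigma>} m"
      by simp
    finally have "L * W2 (\<rho> \<sigma>) (\<rho> \<tau>) \<le> L * (integral {s..\<tau>} m - integral {s..\<sigma>} m)"
      using L(1) by (rule mult_left_mono)
    with 1 2 show ?thesis
      unfolding N_def by (simp add: algebra_simps)
  qed
  have le': "dist (G \<sigma>) (G \<tau>) \<le> dist (N \<sigma>) (N \<tau>)" if "\<sigma> \<in> {s..t}" "\<tau> \<in> {s..t}" for \<sigma> \<tau>
    using le[of \<sigma> \<tau>] le[of \<tau> \<sigma>] that by (cases "\<sigma> \<le> \<tau>") (auto simp: dist_real_def)
  have "continuous_on {s..t} G"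
    using N unfolding continuous_on_iff by (meson le' le_less_trans)
  then show ?thesis by (simp add: G_def)
qed

text \<open>Measurability in time of the measures \<open>\<rho> \<tau>\<close>: the mass of a closed set is the limit of integrals
  of Lipschitz functions, and these depend continuously on time. Clamping time to \<open>[s, t]\<close> makes
  the statement meaningful on the whole line, as nothing is known about the curve outside.\<close>
lemma abs_cont_curve_kernel:
  fixes \<rho> :: "real \<Rightarrow> 'a::euclidean_space measure"
  assumes \<rho>: "abs_cont_curve s t \<rho>" and st: "s \<le> t"
  shows "(\<lambda>\<tau>. \<rho> (max s (min t \<tau>))) \<in> borel \<rightarrow>\<^sub>M prob_algebra borel"
proof -
  define c where "c \<tau> = max s (min t \<tau>)" for \<tau>
  have c: "c \<tau> \<in> {s..t}" for \<tau>
    using st by (auto simp: c_def)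
  have c_cont: "continuous_on UNIV c"
    unfolding c_def by (intro continuous_intros)
  have P: "\<rho> (c \<tau>) \<in> P2" for \<tau>
    using \<rho> c by (simp add: abs_cont_curve_def)
  have "(\<lambda>\<tau>. \<rho> (c \<tau>)) \<in> borel \<rightarrow>\<^sub>M prob_algebra borel"
  proof (rule measurable_prob_algebra_generated)
    show "sets (borel :: 'a measure) = sigma_sets UNIV {F. closed F}"
      unfolding borel_eq_closed by simp
    show "Int_stable {F :: 'a set. closed F}"
      by (auto simp: Int_stable_def)
    show "{F :: 'a set. closed F} \<subseteq> Pow UNIV" by auto
    show "prob_space (\<rho> (c \<tau>))" "sets (\<rho> (c \<tau>)) = sets borel" for \<tau>
      by (rule P2_D(1)[OF P] P2_D(2)[OF P])+
    fix F :: "'a set" assume "F \<in> {F. closed F}"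
    then have F: "closed F" by simp
    show "(\<lambda>\<tau>. emeasure (\<rho> (c \<tau>)) F) \<in> borel_measurable borel"
    proof (cases "F = {}")
      case False
      define f where "f n x = max 0 (1 - real n * infdist x F)" for n x
      have f01: "0 \<le> f n x" "f n x \<le> 1" for n x
        by (auto simp: f_def infdist_nonneg)
      have f_lip: "\<bar>f n x - f n y\<bar> \<le> real n * dist x y" for n x y
      proof -
        have "\<bar>f n x - f n y\<bar> \<le> real n * \<bar>infdist x F - infdist y F\<bar>"
        proof -
          have "\<bar>max 0 (1 - u) - max 0 (1 - v)\<bar> \<le> \<bar>u - v\<bar>" for u v :: real
            by (simp add: max_def abs_if)
          from this[of "real n * infdist x F" "real n * infdist y F"] show ?thesis
            by (simp add: f_def right_diff_distrib[symmetric] abs_mult)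
        qed
        also have "\<dots> \<le> real n * dist x y"
          by (intro mult_left_mono infdist_triangle_abs) simp
        finally show ?thesis .
      qed
      have [measurable]: "f n \<in> borel_measurable borel" for n
        unfolding f_def by (intro borel_measurable_continuous_onI continuous_intros)
      have "continuous_on {s..t} (\<lambda>\<tau>. \<integral>x. f n (snd (\<tau>, x)) \<partial>\<rho> \<tau>)" for n
      proof (rule continuous_on_integral_along_curve[OF \<rho>])
        show "\<bar>f n (snd z) - f n (snd w)\<bar> \<le> real n * dist z w" for z w :: "real \<times> 'a"
          using f_lip[of n "snd z" "snd w"] dist_snd_le[of z w]
          by (meson mult_left_mono of_nat_0_le_iff order_trans)
        show "\<bar>f n (snd z)\<bar> \<le> 1" for z :: "real \<times> 'a"
          using f01[of n "snd z"] by simp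
      qed simp
      then have "continuous_on UNIV (\<lambda>\<tau>. \<integral>x. f n x \<partial>\<rho> (c \<tau>))" for n
        by (intro continuous_on_compose2[OF _ c_cont, of "{s..t}" "\<lambda>\<tau>. \<integral>x. f n x \<partial>\<rho> \<tau>"])
          (use c in auto)
      then have meas: "(\<lambda>\<tau>. \<integral>x. f n x \<partial>\<rho> (c \<tau>)) \<in> borel_measurable borel" for n
        by (rule borel_measurable_continuous_onI)
      have lim: "(\<lambda>n. \<integral>x. f n x \<partial>\<rho> (c \<tau>)) \<longlonglongrightarrow> measure (\<rho> (c \<tau>)) F" for \<tau>
      proof -
        interpret prob_space "\<rho> (c \<tau>)" by (rule P2_D(1)[OF P])
        have [measurable_cong]: "sets (\<rho> (c \<tau>)) = sets borel" by (rule P2_D(2)[OF P])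
        have [measurable]: "F \<in> sets borel" using F by simp
        have "(\<lambda>n. \<integral>x. f n x \<partial>\<rho> (c \<tau>)) \<longlonglongrightarrow> (\<integral>x. indicator F x \<partial>\<rho> (c \<tau>))"
        proof (rule integral_dominated_convergence[where w = "\<lambda>_. 1"])
          show "AE x in \<rho> (c \<tau>). (\<lambda>n. f n x) \<longlonglongrightarrow> indicator F x"
            unfolding f_def by (intro AE_I2 tendsto_closed_indicator F False)
          show "AE x in \<rho> (c \<tau>). norm (f n x) \<le> 1" for n
            using f01 by auto
        qed auto
        then show ?thesis
          by simp
      qed
      have "(\<lambda>\<tau>. measure (\<rho> (c \<tau>)) F) \<in> borel_measurable borel"
        by (rule borel_measurable_LIMSEQ_real[OF lim meas])
      moreover have "emeasure (\<rho> (c \<tau>)) F = ennreal (measure (\<rho> (c \<tau>)) F)" for \<tau>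
      proof -
        interpret prob_space "\<rho> (c \<tau>)" by (rule P2_D(1)[OF P])
        show ?thesis by (rule emeasure_eq_measure)
      qed
      ultimately show ?thesis by simp
    qed simp
  qed
  then show ?thesis by (simp add: c_def)
qed

lemma integral_measurable_kernel:
  fixes H :: "'b \<times> 'c \<Rightarrow> real"
  assumes [measurable]: "H \<in> borel_measurable (M \<Otimes>\<^sub>M N)" "K \<in> M \<rightarrow>\<^sub>M subprob_algebra N"
  shows "(\<lambda>\<tau>. \<integral>x. H (\<tau>, x) \<partial>K \<tau>) \<in> borel_measurable M"
proof -
  have d: "(\<lambda>\<tau>. distr (K \<tau>) (M \<Otimes>\<^sub>M N) (\<lambda>x. (\<tau>, x))) \<in> M \<rightarrow>\<^sub>M subprob_algebra (M \<Otimes>\<^sub>M N)"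
    by (rule measurable_distr2[where M = N]) auto
  have "(\<lambda>\<tau>. \<integral>z. H z \<partial>distr (K \<tau>) (M \<Otimes>\<^sub>M N) (\<lambda>x. (\<tau>, x))) \<in> borel_measurable M"
    by (rule measurable_compose[OF d integral_measurable_subprob_algebra]) fact
  also have "?this \<longleftrightarrow> ?thesis"
  proof (rule measurable_cong)
    fix \<tau> assume \<tau>: "\<tau> \<in> space M"
    have [measurable_cong]: "sets (K \<tau>) = sets N"
      by (rule sets_kernel[OF assms(2) \<tau>])
    show "(\<integral>z. H z \<partial>distr (K \<tau>) (M \<Otimes>\<^sub>M N) (\<lambda>x. (\<tau>, x))) = (\<integral>x. H (\<tau>, x) \<partial>K \<tau>)"
      using \<tau> by (intro integral_distr) auto
  qed
  finally show ?thesis .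
qed

text \<open>The vanishing statements hold off the closure of the support, on whose open complement the
  function is locally constant.\<close>
lemma test_function_derivative:
  fixes \<phi> :: "'b::euclidean_space \<Rightarrow> real"
  assumes "test_function U \<phi>"
  shows "(\<phi> has_derivative frechet_derivative \<phi> (at z)) (at z)"
    and "continuous_on UNIV (\<lambda>z. frechet_derivative \<phi> (at z) h)"
    and "continuous_on UNIV \<phi>"
    and "z \<notin> closure {z. \<phi> z \<noteq> 0} \<Longrightarrow> \<phi> z = 0"
    and "z \<notin> closure {z. \<phi> z \<noteq> 0} \<Longrightarrow> frechet_derivative \<phi> (at z) = (\<lambda>_. 0)"
proof -
  have C: "C_k k \<phi>" for k
    using assms unfolding test_function_def by blast
  have "\<exists>D. (\<forall>z. (\<phi> has_derivative D z) (at z)) \<and> (\<forall>h. continuous_on UNIV (\<lambda>z. D z h))"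
    using C[of "Suc 0"] by (simp only: C_k.simps)
  then obtain D where D0: "\<forall>z. (\<phi> has_derivative D z) (at z)" "\<forall>h. continuous_on UNIV (\<lambda>z. D z h)"
    by (elim exE conjE)
  note D = D0[rule_format]
  have eq: "frechet_derivative \<phi> (at z) = D z" for z
    using frechet_derivative_at[OF D(1)] by simp
  show "(\<phi> has_derivative frechet_derivative \<phi> (at z)) (at z)"
    "continuous_on UNIV (\<lambda>z. frechet_derivative \<phi> (at z) h)"
    unfolding eq by (rule D)+
  show "continuous_on UNIV \<phi>"
    using C[of 0] by simp
  show 0: "\<phi> z = 0" if "z \<notin> closure {z. \<phi> z \<noteq> 0}" for z
    using that subsetD[OF closure_subset, of z "{z. \<phi> z \<noteq> 0}"] by auto
  show "frechet_derivative \<phi> (at z) = (\<lambda>_. 0)" if "z \<notin> closure {z. \<phi> z \<noteq> 0}"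
  proof -
    have "(\<phi> has_derivative (\<lambda>_. 0)) (at z)"
    proof (rule has_derivative_transform_within_open[OF has_derivative_const])
      show "open (- closure {z. \<phi> z \<noteq> 0})" by (intro open_Compl closed_closure)
      show "z \<in> - closure {z. \<phi> z \<noteq> 0}" using that unfolding Compl_iff .
      show "0 = \<phi> w" if "w \<in> - closure {z. \<phi> z \<noteq> 0}" for w
        using 0[OF that[unfolded Compl_iff]] by (rule sym)
    qed
    from frechet_derivative_at[OF this] show ?thesis by simp
  qed
qed

lemma bounded_of_continuous_compact_support:
  fixes f :: "'b::topological_space \<Rightarrow> real"
  assumes "continuous_on UNIV f" "compact S" "\<And>z. z \<notin> S \<Longrightarrow> f z = 0"
  shows "\<exists>B\<ge>0. \<forall>z. \<bar>f z\<bar> \<le> B"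
proof -
  have "bounded (f ` S)"
    using assms(1,2) by (intro compact_imp_bounded compact_continuous_image continuous_on_subset[OF assms(1)]) auto
  then obtain B where "B > 0" "\<forall>x\<in>f ` S. norm x \<le> B"
    unfolding bounded_pos by blast
  then show ?thesis
    using assms(3) by (intro exI[of _ B]) force
qed

text \<open>A derivative with continuous entries and compact support is bounded, hence the function is
  Lipschitz.\<close>
lemma test_function_bounds:
  fixes \<phi> :: "'b::euclidean_space \<Rightarrow> real"
  assumes "test_function U \<phi>"
  obtains C where "0 \<le> C" "\<And>z. \<bar>\<phi> z\<bar> \<le> C" "\<And>z h. \<bar>frechet_derivative \<phi> (at z) h\<bar> \<le> C * norm h"
    "\<And>z w. \<bar>\<phi> z - \<phi> w\<bar> \<le> C * dist z w"
proof -
  let ?D = "\<lambda>z. frechet_derivative \<phi> (at z)"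
  note D = test_function_derivative[OF assms]
  have S: "compact (closure {z. \<phi> z \<noteq> 0})"
    using assms by (simp add: test_function_def)
  obtain B where B: "0 \<le> B" "\<And>z. \<bar>\<phi> z\<bar> \<le> B"
    using bounded_of_continuous_compact_support[OF D(3) S D(4)] by blast
  have "\<exists>B\<ge>0. \<forall>z. \<bar>?D z h\<bar> \<le> B" for h
    using D(5) by (intro bounded_of_continuous_compact_support[OF D(2) S]) simp
  then obtain C where C: "\<And>h. 0 \<le> C h" "\<And>z h. \<bar>?D z h\<bar> \<le> C h"
    by metis
  define C' where "C' = (\<Sum>b\<in>Basis. C b)"
  have C'0: "0 \<le> C'" unfolding C'_def by (intro sum_nonneg C)
  have D_le: "\<bar>?D z h\<bar> \<le> C' * norm h" for z h
  proof -
    interpret bounded_linear "?D z" by (rule has_derivative_bounded_linear[OF D(1)])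
    have "?D z h = ?D z (\<Sum>b\<in>Basis. (h \<bullet> b) *\<^sub>R b)"
      by (simp add: euclidean_representation)
    also have "\<dots> = (\<Sum>b\<in>Basis. (h \<bullet> b) * ?D z b)"
      by (simp add: sum scaleR)
    also have "\<bar>\<dots>\<bar> \<le> (\<Sum>b\<in>Basis. \<bar>(h \<bullet> b) * ?D z b\<bar>)"
      by (rule sum_abs)
    also have "\<dots> \<le> (\<Sum>b\<in>Basis. norm h * C b)"
      unfolding abs_mult by (intro sum_mono mult_mono C Basis_le_norm) auto
    finally show ?thesis
      by (simp add: C'_def sum_distrib_left mult.commute)
  qed
  have lip: "\<bar>\<phi> z - \<phi> w\<bar> \<le> C' * dist z w" for z w
  proof -
    have "norm (\<phi> z - \<phi> w) \<le> C' * norm (z - w)"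
    proof (rule differentiable_bound[of UNIV])
      show "onorm (?D x) \<le> C'" for x
        using C'0 D_le by (intro onorm_bound) auto
    qed (auto intro: D(1))
    then show ?thesis by (simp add: dist_norm)
  qed
  show thesis
  proof (rule that[of "B + C'"])
    show "\<bar>\<phi> z\<bar> \<le> B + C'" for z using B(2)[of z] C'0 by simp
    show "\<bar>?D z h\<bar> \<le> (B + C') * norm h" for z h
      using D_le[of z h] B(1) by (simp add: algebra_simps add_increasing)
    show "\<bar>\<phi> z - \<phi> w\<bar> \<le> (B + C') * dist z w" for z w
      using lip[of z w] B(1) by (simp add: algebra_simps add_increasing)
  qed (use B(1) C'0 in auto)
qed

section \<open>Boundary terms of the continuity equation\<close>

text \<open>The cutoff vanishes within distance \<open>1/N\<close> of the complement of the interval, so multiplying by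
  it moves the support of any test function inside the open time interval.\<close>
lemma test_function_mult_cutoff:
  fixes \<phi> :: "real \<times> 'a::euclidean_space \<Rightarrow> real"
  assumes \<phi>: "test_function U \<phi>" and N: "0 < N"
  shows "test_function ({a<..<b} \<times> UNIV) (\<lambda>z. \<phi> z * cutoff a b N (fst z))"
proof -
  let ?\<psi> = "\<lambda>z. \<phi> z * cutoff a b N (fst z)"
  have C: "C_k k \<phi>" for k
    using \<phi> unfolding test_function_def by blast
  have 1: "C_k k (\<lambda>z::real \<times> 'a. N * (fst z - a) - 1)" for k
    using C_k_affine[OF bounded_linear_const_mult[OF bounded_linear_fst, of N], of k "- (N * a) - 1"]
    by (simp add: algebra_simps)
  have 2: "C_k k (\<lambda>z::real \<times> 'a. N * (b - fst z) - 1)" for k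
    using C_k_affine[OF bounded_linear_const_mult[OF bounded_linear_fst, of "- N"], of k "N * b - 1"]
    by (simp add: algebra_simps)
  have smooth: "C_k k ?\<psi>" for k
    unfolding cutoff_def by (intro C_k_mult C C_k_flat_exp 1 2)
  have S1: "closure {z. ?\<psi> z \<noteq> 0} \<subseteq> closure {z. \<phi> z \<noteq> 0}"
    by (rule closure_mono) auto
  have "compact (closure {z. \<phi> z \<noteq> 0})"
    using \<phi> by (simp add: test_function_def)
  then have "compact (closure {z. \<phi> z \<noteq> 0} \<inter> closure {z. ?\<psi> z \<noteq> 0})"
    by (rule compact_Int_closed) simp
  also have "closure {z. \<phi> z \<noteq> 0} \<inter> closure {z. ?\<psi> z \<noteq> 0} = closure {z. ?\<psi> z \<noteq> 0}"
    using S1 by (rule Int_absorb1)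
  finally have comp: "compact (closure {z. ?\<psi> z \<noteq> 0})" .
  have "closure {z. ?\<psi> z \<noteq> 0} \<subseteq> {a + 1 / N..b - 1 / N} \<times> UNIV"
  proof (rule closure_minimal)
    show "{z. ?\<psi> z \<noteq> 0} \<subseteq> {a + 1 / N..b - 1 / N} \<times> UNIV"
    proof
      fix z assume "z \<in> {z. ?\<psi> z \<noteq> 0}"
      then have "flat_exp 0 (N * (fst z - a) - 1) \<noteq> 0" "flat_exp 0 (N * (b - fst z) - 1) \<noteq> 0"
        by (auto simp: cutoff_def)
      then have "N * (fst z - a) - 1 > 0" "N * (b - fst z) - 1 > 0"
        using flat_exp_nonpos by (meson not_le)+
      then show "z \<in> {a + 1 / N..b - 1 / N} \<times> UNIV"
        using N by (cases z) (auto simp: field_simps)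
    qed
    show "closed ({a + 1 / N..b - 1 / N} \<times> (UNIV :: 'a set))"
      by (intro closed_Times) auto
  qed
  also have "\<dots> \<subseteq> {a<..<b} \<times> UNIV"
    using N by (intro Sigma_mono) (auto simp: less_le_trans[of a "a + 1 / N"] le_less_trans[of _ "b - 1 / N"])
  finally show ?thesis
    using smooth comp by (simp add: test_function_def)
qed

lemma frechet_derivative_mult_cutoff:
  fixes \<phi> :: "real \<times> 'a::euclidean_space \<Rightarrow> real"
  assumes "test_function U \<phi>"
  shows "frechet_derivative (\<lambda>z. \<phi> z * cutoff a b N (fst z)) (at (\<tau>, x)) (1, w) =
    cutoff a b N \<tau> * frechet_derivative \<phi> (at (\<tau>, x)) (1, w) + cutoff_deriv a b N \<tau> * \<phi> (\<tau>, x)"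
proof -
  have "((\<lambda>z. cutoff a b N (fst z)) has_derivative (\<lambda>h. cutoff_deriv a b N \<tau> * fst h)) (at (\<tau>, x))"
  proof (rule has_derivative_compose[of fst fst "(\<tau>, x)" UNIV "cutoff a b N" "(*) (cutoff_deriv a b N \<tau>)"])
    show "(fst has_derivative fst) (at (\<tau>, x))"
      by (rule has_derivative_fst[OF has_derivative_ident])
    show "(cutoff a b N has_derivative (*) (cutoff_deriv a b N \<tau>)) (at (fst (\<tau>, x)))"
      using cutoff_has_derivative[of a b N \<tau>] by (simp add: has_field_derivative_def)
  qed
  from has_derivative_mult[OF test_function_derivative(1)[OF assms] this]
  have "((\<lambda>z. \<phi> z * cutoff a b N (fst z)) has_derivative
     (\<lambda>h. \<phi> (\<tau>, x) * (cutoff_deriv a b N \<tau> * fst h) + frechet_derivative \<phi> (at (\<tau>, x)) h * cutoff a b N \<tau>)) (at (\<tau>, x))"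
    by simp
  from frechet_derivative_at[OF this, symmetric] show ?thesis
    by simp
qed

text \<open>The integrand of the weak continuity equation is integrable for every compactly supported smooth
  function: it is bounded by \<open>C (1 + |v|) \<le> C (2 + |v|\<^sup>2)\<close>, whose space-time integral is finite. Its
  measurability in time rests on the kernel property of the curve, with \<open>v\<close> extended by zero
  outside the interval.\<close>
lemma velocity_field_pairing:
  fixes \<rho> :: "real \<Rightarrow> 'a::euclidean_space measure" and \<phi> :: "real \<times> 'a \<Rightarrow> real"
  assumes ab: "a \<le> b" and \<rho>: "abs_cont_curve a b \<rho>" and v: "velocity_field a b \<rho> v"
    and \<phi>: "test_function U \<phi>"
  shows "AE \<tau> in lborel. \<tau> \<in> {a<..<b} \<longrightarrow>
      integrable (\<rho> \<tau>) (\<lambda>x. frechet_derivative \<phi> (at (\<tau>, x)) (1, v \<tau> x))"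
    and "set_integrable lborel {a<..<b} (\<lambda>\<tau>. \<integral>x. frechet_derivative \<phi> (at (\<tau>, x)) (1, v \<tau> x) \<partial>\<rho> \<tau>)"
proof -
  define K where "K \<tau> = \<rho> (max a (min b \<tau>))" for \<tau>
  have K_eq: "K \<tau> = \<rho> \<tau>" if "\<tau> \<in> {a<..<b}" for \<tau>
    using that by (simp add: K_def)
  have K[measurable]: "K \<in> borel \<rightarrow>\<^sub>M subprob_algebra borel"
    unfolding K_def by (intro measurable_prob_algebraD abs_cont_curve_kernel \<rho> ab)
  have K_P2: "K \<tau> \<in> P2" for \<tau>
    using \<rho> ab by (auto simp: K_def abs_cont_curve_def)
  define V where "V z = indicator ({a<..<b} \<times> UNIV) z *\<^sub>R (case z of (\<tau>, x) \<Rightarrow> v \<tau> x)" for z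
  have V_eq: "V (\<tau>, x) = v \<tau> x" if "\<tau> \<in> {a<..<b}" for \<tau> x
    using that by (simp add: V_def)
  have S: "{a<..<b} \<times> (UNIV :: 'a set) \<in> sets borel"
    by (intro borel_open open_Times) auto
  have V[measurable]: "V \<in> borel_measurable (borel \<Otimes>\<^sub>M borel)"
    using v S unfolding velocity_field_def V_def borel_prod
    by (subst (asm) borel_measurable_restrict_space_iff) auto
  define H where "H z = frechet_derivative \<phi> (at z) (1, V z)" for z
  \<comment> \<open>Expanding the direction in a basis exhibits \<open>H\<close> as a sum of products of measurable
    functions.\<close>
  have H_sum: "H z = (\<Sum>b\<in>Basis. ((1, V z) \<bullet> b) * frechet_derivative \<phi> (at z) b)" for z
  proof -
    interpret bounded_linear "frechet_derivative \<phi> (at z)"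
      by (rule has_derivative_bounded_linear[OF test_function_derivative(1)[OF \<phi>]])
    have "H z = frechet_derivative \<phi> (at z) (\<Sum>b\<in>Basis. ((1, V z) \<bullet> b) *\<^sub>R b)"
      unfolding H_def by (simp only: euclidean_representation)
    then show ?thesis
      by (simp only: sum scaleR real_scaleR_def)
  qed
  have [measurable]: "(\<lambda>z. frechet_derivative \<phi> (at z) h) \<in> borel_measurable (borel \<Otimes>\<^sub>M borel)" for h
    unfolding borel_prod by (rule borel_measurable_continuous_onI[OF test_function_derivative(2)[OF \<phi>]])
  have "(\<lambda>z. (1 :: real, V z)) \<in> borel_measurable (borel \<Otimes>\<^sub>M borel)"
    by measurable
  then have [measurable]: "(\<lambda>z. (1 :: real, V z) \<bullet> h) \<in> borel_measurable (borel \<Otimes>\<^sub>M borel)" for h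
    by (rule borel_measurable_inner) simp
  have H[measurable]: "H \<in> borel_measurable (borel \<Otimes>\<^sub>M borel)"
    unfolding H_sum[abs_def] by measurable
  obtain C where C: "0 \<le> C" "\<And>z h. \<bar>frechet_derivative \<phi> (at z) h\<bar> \<le> C * norm h"
    using test_function_bounds[OF \<phi>] by metis
  define Q where "Q \<tau> = (\<integral>\<^sup>+x. ennreal ((norm (V (\<tau>, x)))\<^sup>2) \<partial>K \<tau>)" for \<tau>
  have Q[measurable]: "Q \<in> borel_measurable borel"
    unfolding Q_def by (rule nn_integral_measurable_subprob_algebra2[OF _ K]) measurable
  have "(\<integral>\<^sup>+\<tau>. Q \<tau> * indicator {a<..<b} \<tau> \<partial>lborel) =
      (\<integral>\<^sup>+\<tau>\<in>{a<..<b}. (\<integral>\<^sup>+x. ennreal ((norm (v \<tau> x))\<^sup>2) \<partial>\<rho> \<tau>) \<partial>lborel)"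
    by (intro nn_integral_cong) (auto simp: Q_def K_eq V_eq indicator_def)
  then have Q_fin: "(\<integral>\<^sup>+\<tau>. Q \<tau> * indicator {a<..<b} \<tau> \<partial>lborel) < \<infinity>"
    using v by (simp add: velocity_field_def)
  have Q_AE: "AE \<tau> in lborel. Q \<tau> * indicator {a<..<b} \<tau> \<noteq> \<infinity>"
    using Q_fin by (intro nn_integral_PInf_AE) auto
  have H_le: "(\<integral>\<^sup>+x. ennreal \<bar>H (\<tau>, x)\<bar> \<partial>K \<tau>) \<le> ennreal C * (2 + Q \<tau>)" for \<tau>
  proof -
    interpret prob_space "K \<tau>" by (rule P2_D(1)[OF K_P2])
    have [measurable_cong]: "sets (K \<tau>) = sets borel" by (rule P2_D(2)[OF K_P2])
    have "\<bar>H (\<tau>, x)\<bar> \<le> C * (2 + (norm (V (\<tau>, x)))\<^sup>2)" for x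
    proof -
      have "norm (1 :: real, V (\<tau>, x)) \<le> 1 + norm (V (\<tau>, x))"
        using norm_Pair_le[of "1 :: real" "V (\<tau>, x)"] by simp
      also have "\<dots> \<le> 2 + (norm (V (\<tau>, x)))\<^sup>2"
      proof -
        have "2 * norm (V (\<tau>, x)) \<le> 1 + (norm (V (\<tau>, x)))\<^sup>2"
          using zero_le_power2[of "norm (V (\<tau>, x)) - 1"] by (simp add: power2_eq_square algebra_simps)
        then show ?thesis
          using norm_ge_zero[of "V (\<tau>, x)"] by linarith
      qed
      finally have "C * norm (1 :: real, V (\<tau>, x)) \<le> C * (2 + (norm (V (\<tau>, x)))\<^sup>2)"
        using C(1) by (rule mult_left_mono)
      then show ?thesis
        unfolding H_def using C(2) order_trans by blast
    qed
    then have "(\<integral>\<^sup>+x. ennreal \<bar>H (\<tau>, x)\<bar> \<partial>K \<tau>) \<le> (\<integral>\<^sup>+x. ennreal (C * (2 + (norm (V (\<tau>, x)))\<^sup>2)) \<partial>K \<tau>)"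
      by (intro nn_integral_mono ennreal_leI)
    also have "\<dots> = (\<integral>\<^sup>+x. ennreal C * (2 + ennreal ((norm (V (\<tau>, x)))\<^sup>2)) \<partial>K \<tau>)"
      using C(1) by (simp add: ennreal_mult ennreal_plus)
    also have "\<dots> = ennreal C * (2 + Q \<tau>)"
      unfolding Q_def by (simp add: nn_integral_cmult nn_integral_add emeasure_space_1)
    finally show ?thesis .
  qed
  have int: "integrable (K \<tau>) (\<lambda>x. H (\<tau>, x))" if "Q \<tau> \<noteq> \<infinity>" for \<tau>
  proof -
    have [measurable_cong]: "sets (K \<tau>) = sets borel" by (rule P2_D(2)[OF K_P2])
    have "ennreal C * (2 + Q \<tau>) < \<infinity>"
      using that by (simp add: ennreal_mult_less_top less_top)
    then have "(\<integral>\<^sup>+x. ennreal \<bar>H (\<tau>, x)\<bar> \<partial>K \<tau>) < \<infinity>"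
      using H_le[of \<tau>] by (rule le_less_trans[rotated])
    then show ?thesis
      by (intro integrableI_bounded) auto
  qed
  show "AE \<tau> in lborel. \<tau> \<in> {a<..<b} \<longrightarrow>
      integrable (\<rho> \<tau>) (\<lambda>x. frechet_derivative \<phi> (at (\<tau>, x)) (1, v \<tau> x))"
    using Q_AE
  proof eventually_elim
    case (elim \<tau>)
    show ?case
    proof
      assume \<tau>: "\<tau> \<in> {a<..<b}"
      then have "integrable (K \<tau>) (\<lambda>x. H (\<tau>, x))"
        using elim by (intro int) simp
      then show "integrable (\<rho> \<tau>) (\<lambda>x. frechet_derivative \<phi> (at (\<tau>, x)) (1, v \<tau> x))"
        using \<tau> by (simp add: H_def K_eq V_eq)
    qed
  qed
  define h where "h \<tau> = (\<integral>x. H (\<tau>, x) \<partial>K \<tau>)" for \<tau>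
  have [measurable]: "h \<in> borel_measurable borel"
    unfolding h_def by (rule integral_measurable_kernel) measurable
  have h_le: "ennreal \<bar>h \<tau>\<bar> \<le> ennreal C * (2 + Q \<tau>)" for \<tau>
  proof (cases "integrable (K \<tau>) (\<lambda>x. H (\<tau>, x))")
    case True
    then show ?thesis
      using integral_norm_bound_ennreal[OF True] H_le[of \<tau>] unfolding h_def by (auto intro: order_trans)
  qed (simp add: h_def not_integrable_integral_eq)
  have "integrable lborel (\<lambda>\<tau>. indicator {a<..<b} \<tau> * h \<tau>)"
  proof (rule integrableI_bounded)
    have "(\<integral>\<^sup>+\<tau>. ennreal (norm (indicator {a<..<b} \<tau> * h \<tau>)) \<partial>lborel) \<le>
        (\<integral>\<^sup>+\<tau>. ennreal C * (2 * indicator {a<..<b} \<tau> + Q \<tau> * indicator {a<..<b} \<tau>) \<partial>lborel)"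
      using h_le by (intro nn_integral_mono) (auto simp: indicator_def)
    also have "\<dots> = ennreal C * (2 * emeasure lborel {a<..<b} + (\<integral>\<^sup>+\<tau>. Q \<tau> * indicator {a<..<b} \<tau> \<partial>lborel))"
      by (simp add: nn_integral_cmult nn_integral_add)
    also have "\<dots> < \<infinity>"
      using Q_fin ab by (simp add: ennreal_mult_less_top)
    finally show "(\<integral>\<^sup>+\<tau>. ennreal (norm (indicator {a<..<b} \<tau> * h \<tau>)) \<partial>lborel) < \<infinity>" .
  qed measurable
  also have "(\<lambda>\<tau>. indicator {a<..<b} \<tau> * h \<tau>) =
      (\<lambda>\<tau>. indicator {a<..<b} \<tau> *\<^sub>R (\<integral>x. frechet_derivative \<phi> (at (\<tau>, x)) (1, v \<tau> x) \<partial>\<rho> \<tau>))"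
    by (auto simp: fun_eq_iff indicator_def h_def H_def K_eq V_eq)
  finally show "set_integrable lborel {a<..<b} (\<lambda>\<tau>. \<integral>x. frechet_derivative \<phi> (at (\<tau>, x)) (1, v \<tau> x) \<partial>\<rho> \<tau>)"
    unfolding set_integrable_def .
qed

text \<open>Test functions in the definition of a velocity field vanish near both ends of the interval; this
  lemma removes that restriction, at the price of boundary terms. The equation is applied to the
  product of \<open>\<phi>\<close> with a cutoff \<open>\<chi>\<close> in time, whose total derivative is
  \<open>\<chi> (\<partial>\<phi> + v \<bullet> \<nabla>\<phi>) + \<chi>' \<phi>\<close>. As the cutoff becomes steep, the first part converges to the
  full integral by dominated convergence. In the second part \<open>\<chi>'\<close> concentrates at the two ends
  with opposite signs, so it converges to the difference of \<open>\<integral> \<phi> (\<tau>, x) d\<rho> \<tau>\<close> at \<open>a\<close> and at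
  \<open>b\<close>; here the continuity of that integral in time enters.\<close>
lemma continuity_equation_boundary_terms:
  fixes \<rho> :: "real \<Rightarrow> 'a::euclidean_space measure" and \<phi> :: "real \<times> 'a \<Rightarrow> real"
  assumes ab: "a < b" and \<rho>: "abs_cont_curve a b \<rho>" and v: "velocity_field a b \<rho> v"
    and \<phi>: "test_function U \<phi>"
  shows "(LBINT \<tau>:{a<..<b}. \<integral>x. frechet_derivative \<phi> (at (\<tau>, x)) (1, v \<tau> x) \<partial>\<rho> \<tau>) =
    (\<integral>x. \<phi> (b, x) \<partial>\<rho> b) - (\<integral>x. \<phi> (a, x) \<partial>\<rho> a)"
proof -
  define h where "h \<tau> = (\<integral>x. frechet_derivative \<phi> (at (\<tau>, x)) (1, v \<tau> x) \<partial>\<rho> \<tau>)" for \<tau>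
  define g where "g \<tau> = (\<integral>x. \<phi> (\<tau>, x) \<partial>\<rho> \<tau>)" for \<tau>
  note pairing = velocity_field_pairing[OF less_imp_le[OF ab] \<rho> v \<phi>]
  have h: "set_integrable lborel {a<..<b} h"
    unfolding h_def by (rule pairing(2))
  obtain C where C: "0 \<le> C" "\<And>z. \<bar>\<phi> z\<bar> \<le> C" "\<And>z w. \<bar>\<phi> z - \<phi> w\<bar> \<le> C * dist z w"
    using test_function_bounds[OF \<phi>] by metis
  have g: "continuous_on {a..b} g"
    unfolding g_def by (rule continuous_on_integral_along_curve[OF \<rho> C(1,3,2)])
  have \<phi>_int: "integrable (\<rho> \<tau>) (\<lambda>x. \<phi> (\<tau>, x))" if "\<tau> \<in> {a..b}" for \<tau>
  proof -
    have P: "\<rho> \<tau> \<in> P2" using \<rho> that by (simp add: abs_cont_curve_def)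
    interpret prob_space "\<rho> \<tau>" by (rule P2_D(1)[OF P])
    have [measurable_cong]: "sets (\<rho> \<tau>) = sets borel" by (rule P2_D(2)[OF P])
    have [measurable]: "(\<lambda>x. \<phi> (\<tau>, x)) \<in> borel_measurable borel"
      by (intro borel_measurable_continuous_onI continuous_on_compose2[OF test_function_derivative(3)[OF \<phi>]] continuous_intros) auto
    show ?thesis
      by (intro integrable_const_bound[of _ C]) (auto simp: C)
  qed
  have cont_int: "set_integrable lborel {a<..<b} f" if "continuous_on {a..b} f" for f :: "real \<Rightarrow> real"
    by (rule set_integrable_subset[OF borel_integrable_atLeastAtMost'[OF that]]) auto
  define N where "N n = real (Suc n)" for n
  have N: "N n > 0" for n by (simp add: N_def)
  have cutoff_meas: "cutoff a b (N n) \<in> borel_measurable lborel" for n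
    using borel_measurable_continuous_onI[OF continuous_on_cutoff(1)] by simp
  have zero: "(LBINT \<tau>:{a<..<b}. cutoff a b (N n) \<tau> * h \<tau>) +
      (LBINT \<tau>:{a<..<b}. cutoff_deriv a b (N n) \<tau> * g \<tau>) = 0" for n
  proof -
    have \<chi>h: "set_integrable lborel {a<..<b} (\<lambda>\<tau>. cutoff a b (N n) \<tau> * h \<tau>)"
    proof (rule set_integrable_bound[OF h])
      have "set_borel_measurable lborel {a<..<b} h"
        using h unfolding set_integrable_def set_borel_measurable_def by (rule borel_measurable_integrable)
      then show "set_borel_measurable lborel {a<..<b} (\<lambda>\<tau>. cutoff a b (N n) \<tau> * h \<tau>)"
        using borel_measurable_times[OF cutoff_meas, of "\<lambda>\<tau>. indicator {a<..<b} \<tau> * h \<tau>"]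
        by (simp add: set_borel_measurable_def mult.left_commute)
      show "AE \<tau> in lborel. \<tau> \<in> {a<..<b} \<longrightarrow> norm (cutoff a b (N n) \<tau> * h \<tau>) \<le> norm (h \<tau>)"
        by (intro AE_I2) (auto simp: abs_mult cutoff_bounds intro!: mult_left_le_one_le)
    qed
    have \<chi>g: "set_integrable lborel {a<..<b} (\<lambda>\<tau>. cutoff_deriv a b (N n) \<tau> * g \<tau>)"
      by (intro cont_int continuous_on_mult g continuous_on_cutoff)
    have AE: "AE \<tau> in lborel. \<tau> \<in> {a<..<b} \<longrightarrow>
        (\<integral>x. frechet_derivative (\<lambda>z. \<phi> z * cutoff a b (N n) (fst z)) (at (\<tau>, x)) (1, v \<tau> x) \<partial>\<rho> \<tau>) =
        cutoff a b (N n) \<tau> * h \<tau> + cutoff_deriv a b (N n) \<tau> * g \<tau>"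
      using pairing(1)
    proof eventually_elim
      case (elim \<tau>)
      show ?case
      proof
        assume \<tau>: "\<tau> \<in> {a<..<b}"
        with elim \<phi>_int[of \<tau>] show "(\<integral>x. frechet_derivative (\<lambda>z. \<phi> z * cutoff a b (N n) (fst z)) (at (\<tau>, x)) (1, v \<tau> x) \<partial>\<rho> \<tau>) =
          cutoff a b (N n) \<tau> * h \<tau> + cutoff_deriv a b (N n) \<tau> * g \<tau>"
          by (simp add: frechet_derivative_mult_cutoff[OF \<phi>] h_def g_def)
      qed
    qed
    have "0 = (LBINT \<tau>:{a<..<b}. \<integral>x. frechet_derivative (\<lambda>z. \<phi> z * cutoff a b (N n) (fst z)) (at (\<tau>, x)) (1, v \<tau> x) \<partial>\<rho> \<tau>)"
      using v test_function_mult_cutoff[OF \<phi> N, of a b n] by (simp add: velocity_field_def)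
    also have "\<dots> = (LBINT \<tau>:{a<..<b}. cutoff a b (N n) \<tau> * h \<tau> + cutoff_deriv a b (N n) \<tau> * g \<tau>)"
    proof -
      have 1: "set_integrable lborel {a<..<b} (\<lambda>\<tau>. \<integral>x. frechet_derivative (\<lambda>z. \<phi> z * cutoff a b (N n) (fst z)) (at (\<tau>, x)) (1, v \<tau> x) \<partial>\<rho> \<tau>)"
        by (rule velocity_field_pairing(2)[OF less_imp_le[OF ab] \<rho> v test_function_mult_cutoff[OF \<phi> N]])
      have 2: "set_integrable lborel {a<..<b} (\<lambda>\<tau>. cutoff a b (N n) \<tau> * h \<tau> + cutoff_deriv a b (N n) \<tau> * g \<tau>)"
        by (rule set_integral_add(1)[OF \<chi>h \<chi>g])
      show ?thesis
        unfolding set_lebesgue_integral_def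
      proof (rule integral_cong_AE[OF borel_measurable_integrable[OF 1[unfolded set_integrable_def]]
            borel_measurable_integrable[OF 2[unfolded set_integrable_def]]])
        show "AE \<tau> in lborel. indicator {a<..<b} \<tau> *\<^sub>R
            (\<integral>x. frechet_derivative (\<lambda>z. \<phi> z * cutoff a b (N n) (fst z)) (at (\<tau>, x)) (1, v \<tau> x) \<partial>\<rho> \<tau>) =
          indicator {a<..<b} \<tau> *\<^sub>R (cutoff a b (N n) \<tau> * h \<tau> + cutoff_deriv a b (N n) \<tau> * g \<tau>)"
          using AE by eventually_elim (auto simp: indicator_def)
      qed
    qed
    also have "\<dots> = (LBINT \<tau>:{a<..<b}. cutoff a b (N n) \<tau> * h \<tau>) + (LBINT \<tau>:{a<..<b}. cutoff_deriv a b (N n) \<tau> * g \<tau>)"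
      by (rule set_integral_add(2)[OF \<chi>h \<chi>g])
    finally show ?thesis by simp
  qed
  have lim1: "(\<lambda>n. LBINT \<tau>:{a<..<b}. cutoff a b (N n) \<tau> * h \<tau>) \<longlonglongrightarrow> (LBINT \<tau>:{a<..<b}. h \<tau>)"
    unfolding set_lebesgue_integral_def
  proof (rule integral_dominated_convergence)
    have m[measurable]: "(\<lambda>\<tau>. indicator {a<..<b} \<tau> *\<^sub>R h \<tau>) \<in> borel_measurable lborel"
      using h unfolding set_integrable_def by (rule borel_measurable_integrable)
    then show "(\<lambda>\<tau>. indicator {a<..<b} \<tau> *\<^sub>R h \<tau>) \<in> borel_measurable lborel" .
    show "(\<lambda>\<tau>. indicator {a<..<b} \<tau> *\<^sub>R (cutoff a b (N n) \<tau> * h \<tau>)) \<in> borel_measurable lborel" for n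
      using borel_measurable_times[OF cutoff_meas m, of n]
      by (simp add: mult.left_commute)
    show "integrable lborel (\<lambda>\<tau>. norm (indicator {a<..<b} \<tau> *\<^sub>R h \<tau>))"
      using h unfolding set_integrable_def by (rule integrable_norm)
    show "AE \<tau> in lborel. (\<lambda>n. indicator {a<..<b} \<tau> *\<^sub>R (cutoff a b (N n) \<tau> * h \<tau>)) \<longlonglongrightarrow> indicator {a<..<b} \<tau> *\<^sub>R h \<tau>"
    proof (rule AE_I2)
      fix \<tau>
      show "(\<lambda>n. indicator {a<..<b} \<tau> *\<^sub>R (cutoff a b (N n) \<tau> * h \<tau>)) \<longlonglongrightarrow> indicator {a<..<b} \<tau> *\<^sub>R h \<tau>"
        using tendsto_mult[OF cutoff_tendsto_1[of a \<tau> b] tendsto_const[of "h \<tau>"]]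
        by (cases "\<tau> \<in> {a<..<b}") (auto simp: N_def)
    qed
    show "AE \<tau> in lborel. norm (indicator {a<..<b} \<tau> *\<^sub>R (cutoff a b (N n) \<tau> * h \<tau>)) \<le> norm (indicator {a<..<b} \<tau> *\<^sub>R h \<tau>)" for n
      by (intro AE_I2) (auto simp: indicator_def abs_mult cutoff_bounds intro!: mult_left_le_one_le)
  qed
  have lim2: "(\<lambda>n. LBINT \<tau>:{a<..<b}. cutoff_deriv a b (N n) \<tau> * g \<tau>) \<longlonglongrightarrow> g a - g b"
  proof -
    have "(LBINT \<tau>:{a<..<b}. cutoff_deriv a b (N n) \<tau> * g \<tau>) =
      (LBINT \<tau>:{a<..<b}. N n * flat_exp (Suc 0) (N n * (\<tau> - a) - 1) * flat_exp 0 (N n * (b - \<tau>) - 1) * g \<tau>) -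
      (LBINT \<tau>:{a<..<b}. N n * flat_exp 0 (N n * (\<tau> - a) - 1) * flat_exp (Suc 0) (N n * (b - \<tau>) - 1) * g \<tau>)" for n
      unfolding cutoff_deriv_def left_diff_distrib
      by (rule set_integral_diff(2)) (intro cont_int continuous_intros g)+
    then show ?thesis
      using tendsto_diff[OF cutoff_derivative_concentrates[OF ab g] cutoff_derivative_concentrates_right[OF ab g]]
      unfolding N_def by (simp only:)
  qed
  have "(\<lambda>n. 0) \<longlonglongrightarrow> (LBINT \<tau>:{a<..<b}. h \<tau>) + (g a - g b)"
    using tendsto_add[OF lim1 lim2] unfolding zero .
  then have "(LBINT \<tau>:{a<..<b}. h \<tau>) + (g a - g b) = 0"
    using LIMSEQ_unique tendsto_const by blast
  then show ?thesis
    by (simp add: h_def g_def)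
qed

section \<open>Additivity of the action and restriction of curves\<close>

text \<open>For a measurable integrand this is additivity of the integral. Here \<open>f\<close> is arbitrary, because
  the potential along a curve may fail to be measurable in time. The integral is then
  the supremum over simple minorants, and a simple minorant on \<open>A \<union> B\<close> is the same as a pair of simple minorants on \<open>A\<close> and on \<open>B\<close>.\<close>
lemma nn_integral_Un_disjoint:
  assumes A: "A \<in> sets M" and B: "B \<in> sets M" and disj: "A \<inter> B = {}"
  shows "(\<integral>\<^sup>+x\<in>A \<union> B. f x \<partial>M) = (\<integral>\<^sup>+x\<in>A. f x \<partial>M) + (\<integral>\<^sup>+x\<in>B. f x \<partial>M)"
proof (rule antisym)
  let ?S = "\<lambda>h. {g. simple_function M g \<and> g \<le> h}"
  let ?f = "\<lambda>C x. f x * indicator C x"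
  show "(\<integral>\<^sup>+x\<in>A \<union> B. f x \<partial>M) \<le> (\<integral>\<^sup>+x\<in>A. f x \<partial>M) + (\<integral>\<^sup>+x\<in>B. f x \<partial>M)"
    unfolding nn_integral_def[of M "?f (A \<union> B)"]
  proof (rule SUP_least)
    fix g assume "g \<in> ?S (?f (A \<union> B))"
    then have g: "simple_function M g" and le: "\<And>x. g x \<le> ?f (A \<union> B) x"
      by (auto simp: le_fun_def)
    have [measurable]: "g \<in> borel_measurable M" "A \<in> sets M" "B \<in> sets M"
      using borel_measurable_simple_function[OF g] A B by auto
    have "integral\<^sup>S M g = (\<integral>\<^sup>+x. g x \<partial>M)"
      by (rule nn_integral_eq_simple_integral[OF g, symmetric])
    also have "\<dots> = (\<integral>\<^sup>+x. g x * indicator A x + g x * indicator B x \<partial>M)"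
    proof (rule nn_integral_cong)
      fix x
      show "g x = g x * indicator A x + g x * indicator B x"
        using le[of x] disj by (auto simp: indicator_def)
    qed
    also have "\<dots> = (\<integral>\<^sup>+x. g x * indicator A x \<partial>M) + (\<integral>\<^sup>+x. g x * indicator B x \<partial>M)"
      by (rule nn_integral_add) measurable
    also have "\<dots> \<le> (\<integral>\<^sup>+x\<in>A. f x \<partial>M) + (\<integral>\<^sup>+x\<in>B. f x \<partial>M)"
    proof (intro add_mono nn_integral_mono)
      fix x
      show "g x * indicator A x \<le> f x * indicator A x" "g x * indicator B x \<le> f x * indicator B x"
        using le[of x] by (auto simp: indicator_def)
    qed
    finally show "integral\<^sup>S M g \<le> (\<integral>\<^sup>+x\<in>A. f x \<partial>M) + (\<integral>\<^sup>+x\<in>B. f x \<partial>M)" .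
  qed
  have ne: "?S (?f C) \<noteq> {}" for C
    by (auto intro!: exI[of _ "\<lambda>_. 0"] simp: le_fun_def)
  have "integral\<^sup>S M g1 + integral\<^sup>S M g2 \<le> (\<integral>\<^sup>+x\<in>A \<union> B. f x \<partial>M)"
    if "g1 \<in> ?S (?f A)" "g2 \<in> ?S (?f B)" for g1 g2
  proof -
    have s: "simple_function M g1" "simple_function M g2"
      and le: "\<And>x. g1 x \<le> ?f A x" "\<And>x. g2 x \<le> ?f B x"
      using that by (auto simp: le_fun_def)
    have "integral\<^sup>S M g1 + integral\<^sup>S M g2 = (\<integral>\<^sup>+x. g1 x + g2 x \<partial>M)"
      using s by (simp add: nn_integral_eq_simple_integral[symmetric] nn_integral_add borel_measurable_simple_function)
    also have "\<dots> \<le> (\<integral>\<^sup>+x\<in>A \<union> B. f x \<partial>M)"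
    proof (rule nn_integral_mono)
      fix x
      show "g1 x + g2 x \<le> f x * indicator (A \<union> B) x"
        using le[of x] disj by (cases "x \<in> A"; cases "x \<in> B") auto
    qed
    finally show ?thesis .
  qed
  then show "(\<integral>\<^sup>+x\<in>A. f x \<partial>M) + (\<integral>\<^sup>+x\<in>B. f x \<partial>M) \<le> (\<integral>\<^sup>+x\<in>A \<union> B. f x \<partial>M)"
    unfolding nn_integral_def[of M "?f A"] nn_integral_def[of M "?f B"]
    unfolding ennreal_SUP_add_left[OF ne, symmetric] ennreal_SUP_add_right[OF ne]
    by (intro SUP_least)
qed

lemma nn_integral_split_interval:
  fixes a b c :: real
  assumes "a < b" "b < c"
  shows "(\<integral>\<^sup>+\<tau>\<in>{a<..<c}. f \<tau> \<partial>lborel) =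
    (\<integral>\<^sup>+\<tau>\<in>{a<..<b}. f \<tau> \<partial>lborel) + (\<integral>\<^sup>+\<tau>\<in>{b<..<c}. f \<tau> \<partial>lborel)"
proof -
  have "(\<integral>\<^sup>+\<tau>\<in>{a<..<c}. f \<tau> \<partial>lborel) = (\<integral>\<^sup>+\<tau>\<in>{a<..<b} \<union> {b<..<c}. f \<tau> \<partial>lborel)"
    using AE_lborel_singleton[of b] assms
    by (intro nn_integral_cong_AE) (auto simp: indicator_def elim!: eventually_mono)
  then show ?thesis
    by (simp add: nn_integral_Un_disjoint)
qed

lemma kinetic_action_split:
  assumes "a < b" "b < c"
  shows "kinetic_action a c \<rho> v = kinetic_action a b \<rho> v + kinetic_action b c \<rho> v"
  unfolding kinetic_action_def nn_integral_split_interval[OF assms] by (rule plus_ennreal.rep_eq)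

lemma potential_action_split:
  assumes "a < b" "b < c"
  shows "potential_action E a c \<rho> = potential_action E a b \<rho> + potential_action E b c \<rho>"
  unfolding potential_action_def nn_integral_split_interval[OF assms] by (rule plus_ennreal.rep_eq)

lemma action_cong:
  assumes "\<And>\<tau>. \<tau> \<in> {a<..<b} \<Longrightarrow> \<rho> \<tau> = \<rho>' \<tau>"
  shows "(\<And>\<tau>. \<tau> \<in> {a<..<b} \<Longrightarrow> v \<tau> = v' \<tau>) \<Longrightarrow> kinetic_action a b \<rho> v = kinetic_action a b \<rho>' v'"
    and "potential_action E a b \<rho> = potential_action E a b \<rho>'"
  unfolding kinetic_action_def potential_action_def using assms
  by (auto intro!: arg_cong[where f = enn2ereal] nn_integral_cong simp: indicator_def)

lemma kinetic_action_nonneg: "0 \<le> kinetic_action a b \<rho> v"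
  and potential_action_nonneg: "0 \<le> potential_action E a b \<rho>"
  by (simp_all add: kinetic_action_def potential_action_def)

lemma AC2_subinterval:
  assumes \<rho>: "\<rho> \<in> AC2 s t" and "s \<le> a" "b \<le> t"
  shows "\<rho> \<in> AC2 a b"
proof -
  obtain m where P: "\<And>\<tau>. \<tau> \<in> {s..t} \<Longrightarrow> \<rho> \<tau> \<in> P2" and m: "set_integrable lborel {s..t} m"
    and W: "\<And>a b. s \<le> a \<Longrightarrow> a \<le> b \<Longrightarrow> b \<le> t \<Longrightarrow> W2 (\<rho> a) (\<rho> b) \<le> (LBINT \<tau>:{a..b}. m \<tau>)"
    using \<rho> unfolding AC2_def abs_cont_curve_def by blast
  obtain g where g: "AE \<tau> in lborel. \<tau> \<in> {s<..<t} \<longrightarrow> has_metric_derivative \<rho> (g \<tau>) \<tau>"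
    "set_borel_measurable lborel {s<..<t} g" "set_integrable lborel {s<..<t} (\<lambda>\<tau>. (g \<tau>)\<^sup>2)"
    using \<rho> unfolding AC2_def by blast
  have "abs_cont_curve a b \<rho>"
    unfolding abs_cont_curve_def
  proof (intro conjI exI[of _ m] ballI allI impI)
    show "set_integrable lborel {a..b} m"
      by (rule set_integrable_subset[OF m]) (use assms in auto)
  qed (use assms P W in auto)
  moreover have "AE \<tau> in lborel. \<tau> \<in> {a<..<b} \<longrightarrow> has_metric_derivative \<rho> (g \<tau>) \<tau>"
    using g(1) by eventually_elim (use assms in auto)
  moreover have "set_borel_measurable lborel {a<..<b} g"
    by (rule set_borel_measurable_subset[OF g(2)]) (use assms in auto)
  moreover have "set_integrable lborel {a<..<b} (\<lambda>\<tau>. (g \<tau>)\<^sup>2)"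
    by (rule set_integrable_subset[OF g(3)]) (use assms in auto)
  ultimately show ?thesis
    unfolding AC2_def by blast
qed

text \<open>A test function on the smaller interval is one on the larger interval, and its derivative vanishes
  at all other times, so both integrals in the weak equation agree.\<close>
lemma velocity_field_subinterval:
  fixes \<rho> :: "real \<Rightarrow> 'a::euclidean_space measure"
  assumes v: "velocity_field s t \<rho> v" and ab: "s \<le> a" "b \<le> t"
  shows "velocity_field a b \<rho> v"
  unfolding velocity_field_def
proof (intro conjI allI impI)
  have sub: "{a<..<b} \<times> (UNIV :: 'a set) \<subseteq> {s<..<t} \<times> UNIV"
    using ab by auto
  show "(\<lambda>(\<tau>, x). v \<tau> x) \<in> borel_measurable (restrict_space borel ({a<..<b} \<times> UNIV))"
    using v unfolding velocity_field_def by (blast intro: measurable_restrict_mono[OF _ sub])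
  have "(\<integral>\<^sup>+\<tau>\<in>{a<..<b}. (\<integral>\<^sup>+x. ennreal ((norm (v \<tau> x))\<^sup>2) \<partial>\<rho> \<tau>) \<partial>lborel) \<le>
     (\<integral>\<^sup>+\<tau>\<in>{s<..<t}. (\<integral>\<^sup>+x. ennreal ((norm (v \<tau> x))\<^sup>2) \<partial>\<rho> \<tau>) \<partial>lborel)"
    using ab by (intro nn_integral_mono) (auto simp: indicator_def)
  then show "(\<integral>\<^sup>+\<tau>\<in>{a<..<b}. (\<integral>\<^sup>+x. ennreal ((norm (v \<tau> x))\<^sup>2) \<partial>\<rho> \<tau>) \<partial>lborel) < \<infinity>"
    using v unfolding velocity_field_def by (auto intro: le_less_trans)
  fix \<phi> :: "real \<times> 'a \<Rightarrow> real" assume \<phi>: "test_function ({a<..<b} \<times> UNIV) \<phi>"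
  then have \<phi>': "test_function ({s<..<t} \<times> UNIV) \<phi>"
    using sub unfolding test_function_def by blast
  let ?h = "\<lambda>\<tau>. \<integral>x. frechet_derivative \<phi> (at (\<tau>, x)) (1, v \<tau> x) \<partial>\<rho> \<tau>"
  have zero: "?h \<tau> = 0" if "\<tau> \<notin> {a<..<b}" for \<tau>
  proof -
    have "(\<tau>, x) \<notin> closure {z. \<phi> z \<noteq> 0}" for x
      using \<phi> that unfolding test_function_def by blast
    then have "frechet_derivative \<phi> (at (\<tau>, x)) = (\<lambda>_. 0)" for x
      by (rule test_function_derivative(5)[OF \<phi>])
    then show ?thesis by simp
  qed
  have "(LBINT \<tau>:{a<..<b}. ?h \<tau>) = (LBINT \<tau>:{s<..<t}. ?h \<tau>)"
    unfolding set_lebesgue_integral_def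
  proof (rule Bochner_Integration.integral_cong)
    fix \<tau> show "indicator {a<..<b} \<tau> *\<^sub>R ?h \<tau> = indicator {s<..<t} \<tau> *\<^sub>R ?h \<tau>"
      using zero[of \<tau>] ab by (cases "\<tau> \<in> {a<..<b}") auto
  qed simp
  also have "\<dots> = 0"
    using v \<phi>' unfolding velocity_field_def by blast
  finally show "(LBINT \<tau>:{a<..<b}. ?h \<tau>) = 0" .
qed

section \<open>Concatenation of curves\<close>

definition concat_curve :: "real \<Rightarrow> (real \<Rightarrow> 'b) \<Rightarrow> (real \<Rightarrow> 'b) \<Rightarrow> real \<Rightarrow> 'b" where
  "concat_curve b \<rho>1 \<rho>2 \<tau> = (if \<tau> \<le> b then \<rho>1 \<tau> else \<rho>2 \<tau>)"

text \<open>At the single time \<open>b\<close> neither field is known to be measurable in space, since velocity fields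
  are only constrained on open time intervals; hence the value \<open>0\<close> there.\<close>
definition concat_field ::
    "real \<Rightarrow> (real \<Rightarrow> 'a \<Rightarrow> 'b::zero) \<Rightarrow> (real \<Rightarrow> 'a \<Rightarrow> 'b) \<Rightarrow> real \<Rightarrow> 'a \<Rightarrow> 'b" where
  "concat_field b v1 v2 \<tau> x = (if \<tau> < b then v1 \<tau> x else if \<tau> = b then 0 else v2 \<tau> x)"

lemma has_metric_derivative_cong:
  assumes "open U" "\<tau> \<in> U" "\<And>\<sigma>. \<sigma> \<in> U \<Longrightarrow> \<rho> \<sigma> = \<rho>' \<sigma>"
  shows "has_metric_derivative \<rho> l \<tau> \<longleftrightarrow> has_metric_derivative \<rho>' l \<tau>"
  unfolding has_metric_derivative_def
proof (rule tendsto_cong)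
  have "\<forall>\<^sub>F \<sigma> in at \<tau>. \<sigma> \<in> U"
    using assms by (intro eventually_at_in_open')
  then show "\<forall>\<^sub>F \<sigma> in at \<tau>. W2 (\<rho> \<sigma>) (\<rho> \<tau>) / \<bar>\<sigma> - \<tau>\<bar> = W2 (\<rho>' \<sigma>) (\<rho>' \<tau>) / \<bar>\<sigma> - \<tau>\<bar>"
    by eventually_elim (simp add: assms)
qed

text \<open>For an interval that contains the junction time in its interior, the triangle inequality for the
  distance through the common measure at the junction reduces to the two pieces.\<close>
lemma abs_cont_curve_concat:
  fixes \<rho>1 \<rho>2 :: "real \<Rightarrow> 'a::euclidean_space measure"
  assumes \<rho>1: "abs_cont_curve a b \<rho>1" and \<rho>2: "abs_cont_curve b c \<rho>2" and eq: "\<rho>1 b = \<rho>2 b"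
    and abc: "a < b" "b < c"
  shows "abs_cont_curve a c (concat_curve b \<rho>1 \<rho>2)"
proof -
  let ?\<rho> = "concat_curve b \<rho>1 \<rho>2"
  have \<rho>_left: "?\<rho> \<tau> = \<rho>1 \<tau>" if "\<tau> \<le> b" for \<tau>
    using that by (simp add: concat_curve_def)
  have \<rho>_right: "?\<rho> \<tau> = \<rho>2 \<tau>" if "b \<le> \<tau>" for \<tau>
    using that eq by (auto simp: concat_curve_def)
  obtain m1 where P1: "\<And>\<tau>. \<tau> \<in> {a..b} \<Longrightarrow> \<rho>1 \<tau> \<in> P2" and m1: "set_integrable lborel {a..b} m1"
    and W1: "\<And>x y. a \<le> x \<Longrightarrow> x \<le> y \<Longrightarrow> y \<le> b \<Longrightarrow> W2 (\<rho>1 x) (\<rho>1 y) \<le> (LBINT \<tau>:{x..y}. m1 \<tau>)"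
    using \<rho>1 unfolding abs_cont_curve_def by blast
  obtain m2 where P2: "\<And>\<tau>. \<tau> \<in> {b..c} \<Longrightarrow> \<rho>2 \<tau> \<in> P2" and m2: "set_integrable lborel {b..c} m2"
    and W2: "\<And>x y. b \<le> x \<Longrightarrow> x \<le> y \<Longrightarrow> y \<le> c \<Longrightarrow> W2 (\<rho>2 x) (\<rho>2 y) \<le> (LBINT \<tau>:{x..y}. m2 \<tau>)"
    using \<rho>2 unfolding abs_cont_curve_def by blast
  define m where "m \<tau> = (if \<tau> \<le> b then m1 \<tau> else m2 \<tau>)" for \<tau>
  have P: "?\<rho> \<tau> \<in> P2" if "\<tau> \<in> {a..c}" for \<tau>
    using that P1 P2 by (auto simp: concat_curve_def)
  have "set_integrable lborel ({a..b} \<union> {b<..c}) m"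
  proof (rule set_integrable_Un)
    show "set_integrable lborel {a..b} m"
      using m1 by (subst set_integrable_cong[of lborel lborel "{a..b}" "{a..b}" m m1]) (auto simp: m_def)
    have "set_integrable lborel {b<..c} m2"
      by (rule set_integrable_subset[OF m2]) auto
    then show "set_integrable lborel {b<..c} m"
      by (subst set_integrable_cong[of lborel lborel "{b<..c}" "{b<..c}" m m2]) (auto simp: m_def)
  qed auto
  also have "{a..b} \<union> {b<..c} = {a..c}"
    using abc by auto
  finally have m: "set_integrable lborel {a..c} m" .
  have sub: "set_integrable lborel {x..y} m" if "a \<le> x" "y \<le> c" for x y
    by (rule set_integrable_subset[OF m]) (use that in auto)
  have left: "W2 (?\<rho> x) (?\<rho> y) \<le> integral {x..y} m" if "a \<le> x" "x \<le> y" "y \<le> b" for x y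
  proof -
    have "W2 (?\<rho> x) (?\<rho> y) \<le> (LBINT \<tau>:{x..y}. m1 \<tau>)"
      using W1[OF that] that by (simp add: \<rho>_left)
    also have "\<dots> = (LBINT \<tau>:{x..y}. m \<tau>)"
      using that by (intro set_lebesgue_integral_cong) (auto simp: m_def)
    also have "\<dots> = integral {x..y} m"
      using that abc by (intro set_borel_integral_eq_integral sub) auto
    finally show ?thesis .
  qed
  have right: "W2 (?\<rho> x) (?\<rho> y) \<le> integral {x..y} m" if "b \<le> x" "x \<le> y" "y \<le> c" for x y
  proof -
    have "set_integrable lborel {x..y} m2"
      by (rule set_integrable_subset[OF m2]) (use that in auto)
    then have "W2 (?\<rho> x) (?\<rho> y) \<le> integral {x..y} m2"
      using W2[OF that] that by (simp add: \<rho>_right set_borel_integral_eq_integral)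
    also have "\<dots> = integral {x..y} m"
      by (rule integral_spike[of "{b}"]) (use that in \<open>auto simp: m_def\<close>)
    finally show ?thesis .
  qed
  have "W2 (?\<rho> x) (?\<rho> y) \<le> integral {x..y} m" if xy: "a \<le> x" "x \<le> y" "y \<le> c" for x y
  proof -
    consider "y \<le> b" | "b \<le> x" | "x < b" "b < y" by linarith
    then show ?thesis
    proof cases
      case 3
      have "W2 (?\<rho> x) (?\<rho> y) \<le> W2 (?\<rho> x) (?\<rho> b) + W2 (?\<rho> b) (?\<rho> y)"
        using xy 3 by (intro W2_triangle P) auto
      also have "\<dots> \<le> integral {x..b} m + integral {b..y} m"
        using left[of x b] right[of b y] xy 3 by simp
      also have "\<dots> = integral {x..y} m"
        using xy 3 by (intro Henstock_Kurzweil_Integration.integral_combine set_borel_integral_eq_integral(1) sub) auto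
      finally show ?thesis .
    qed (use left right xy in auto)
  qed
  then have "W2 (?\<rho> x) (?\<rho> y) \<le> (LBINT \<tau>:{x..y}. m \<tau>)" if "a \<le> x" "x \<le> y" "y \<le> c" for x y
    using that set_borel_integral_eq_integral(2)[OF sub[OF that(1,3)]] by simp
  then show ?thesis
    unfolding abs_cont_curve_def using P m by blast
qed

text \<open>The metric derivative is a local notion, so away from the junction time it is the one of the piece
  in question, and the junction time alone is a null set.\<close>
lemma AC2_concat:
  fixes \<rho>1 \<rho>2 :: "real \<Rightarrow> 'a::euclidean_space measure"
  assumes \<rho>1: "\<rho>1 \<in> AC2 a b" and \<rho>2: "\<rho>2 \<in> AC2 b c" and eq: "\<rho>1 b = \<rho>2 b" and abc: "a < b" "b < c"
  shows "concat_curve b \<rho>1 \<rho>2 \<in> AC2 a c"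
proof -
  let ?\<rho> = "concat_curve b \<rho>1 \<rho>2"
  obtain g1 where g1: "AE \<tau> in lborel. \<tau> \<in> {a<..<b} \<longrightarrow> has_metric_derivative \<rho>1 (g1 \<tau>) \<tau>"
    "set_borel_measurable lborel {a<..<b} g1" "set_integrable lborel {a<..<b} (\<lambda>\<tau>. (g1 \<tau>)\<^sup>2)"
    using \<rho>1 unfolding AC2_def by blast
  obtain g2 where g2: "AE \<tau> in lborel. \<tau> \<in> {b<..<c} \<longrightarrow> has_metric_derivative \<rho>2 (g2 \<tau>) \<tau>"
    "set_borel_measurable lborel {b<..<c} g2" "set_integrable lborel {b<..<c} (\<lambda>\<tau>. (g2 \<tau>)\<^sup>2)"
    using \<rho>2 unfolding AC2_def by blast
  define g where "g \<tau> = indicator {a<..<b} \<tau> *\<^sub>R g1 \<tau> + indicator {b<..<c} \<tau> *\<^sub>R g2 \<tau>" for \<tau>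
  have "abs_cont_curve a c ?\<rho>"
    using \<rho>1 \<rho>2 eq abc by (intro abs_cont_curve_concat) (auto simp: AC2_def)
  moreover have "AE \<tau> in lborel. \<tau> \<in> {a<..<c} \<longrightarrow> has_metric_derivative ?\<rho> (g \<tau>) \<tau>"
    using g1(1) g2(1) AE_lborel_singleton[of b]
  proof eventually_elim
    case (elim \<tau>)
    show ?case
    proof
      assume \<tau>: "\<tau> \<in> {a<..<c}"
      show "has_metric_derivative ?\<rho> (g \<tau>) \<tau>"
      proof (cases "\<tau> < b")
        case True
        then have "has_metric_derivative \<rho>1 (g \<tau>) \<tau>"
          using elim(1) \<tau> by (simp add: g_def)
        then show ?thesis
          using True by (subst has_metric_derivative_cong[of "{..<b}" \<tau> ?\<rho> \<rho>1]) (auto simp: concat_curve_def)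
      next
        case False
        then have "has_metric_derivative \<rho>2 (g \<tau>) \<tau>"
          using elim(2,3) \<tau> by (simp add: g_def)
        then show ?thesis
          using False elim(3)
          by (subst has_metric_derivative_cong[of "{b<..}" \<tau> ?\<rho> \<rho>2]) (auto simp: concat_curve_def)
      qed
    qed
  qed
  moreover have "set_borel_measurable lborel {a<..<c} g"
  proof -
    have "(\<lambda>\<tau>. indicator {a<..<c} \<tau> *\<^sub>R g \<tau>) = (\<lambda>\<tau>. indicator {a<..<b} \<tau> *\<^sub>R g1 \<tau> + indicator {b<..<c} \<tau> *\<^sub>R g2 \<tau>)"
      using abc by (auto simp: fun_eq_iff g_def indicator_def)
    then show ?thesis
      using borel_measurable_add[OF g1(2)[unfolded set_borel_measurable_def] g2(2)[unfolded set_borel_measurable_def]]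
      unfolding set_borel_measurable_def by simp
  qed
  moreover have "set_integrable lborel {a<..<c} (\<lambda>\<tau>. (g \<tau>)\<^sup>2)"
  proof -
    have "(\<lambda>\<tau>. indicator {a<..<c} \<tau> *\<^sub>R (g \<tau>)\<^sup>2) =
        (\<lambda>\<tau>. indicator {a<..<b} \<tau> *\<^sub>R (g1 \<tau>)\<^sup>2 + indicator {b<..<c} \<tau> *\<^sub>R (g2 \<tau>)\<^sup>2)"
      using abc by (auto simp: fun_eq_iff g_def indicator_def)
    then show ?thesis
      using Bochner_Integration.integrable_add[OF g1(3)[unfolded set_integrable_def] g2(3)[unfolded set_integrable_def]]
      unfolding set_integrable_def by simp
  qed
  ultimately show ?thesis
    unfolding AC2_def by blast
qed

text \<open>A test function for the concatenated curve need not vanish at the junction time. The pieces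
  contribute the boundary terms \<open>\<integral> \<phi> (b, x) d\<rho>1 b\<close> and \<open>- \<integral> \<phi> (b, x) d\<rho>2 b\<close>, which cancel
  because the curves meet; at the outer ends \<open>\<phi>\<close> vanishes.\<close>
lemma velocity_field_concat:
  fixes \<rho>1 \<rho>2 :: "real \<Rightarrow> 'a::euclidean_space measure"
  assumes \<rho>1: "abs_cont_curve a b \<rho>1" and \<rho>2: "abs_cont_curve b c \<rho>2" and eq: "\<rho>1 b = \<rho>2 b"
    and v1: "velocity_field a b \<rho>1 v1" and v2: "velocity_field b c \<rho>2 v2"
    and abc: "a < b" "b < c"
  shows "velocity_field a c (concat_curve b \<rho>1 \<rho>2) (concat_field b v1 v2)"
  unfolding velocity_field_def
proof (intro conjI allI impI)
  let ?\<rho> = "concat_curve b \<rho>1 \<rho>2" and ?v = "concat_field b v1 v2"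
  have left: "?\<rho> \<tau> = \<rho>1 \<tau>" "?v \<tau> = v1 \<tau>" if "\<tau> \<in> {a<..<b}" for \<tau>
    using that by (auto simp: concat_curve_def concat_field_def fun_eq_iff)
  have right: "?\<rho> \<tau> = \<rho>2 \<tau>" "?v \<tau> = v2 \<tau>" if "\<tau> \<in> {b<..<c}" for \<tau>
    using that by (auto simp: concat_curve_def concat_field_def fun_eq_iff)
  have meas: "(\<lambda>(\<tau>, x). v \<tau> x) \<in> borel_measurable (restrict_space borel ({x<..<y} \<times> UNIV)) \<longleftrightarrow>
      (\<lambda>z. indicator ({x<..<y} \<times> UNIV) z *\<^sub>R (case z of (\<tau>, x) \<Rightarrow> v \<tau> x)) \<in> borel_measurable borel"
    for x y :: real and v :: "real \<Rightarrow> 'a \<Rightarrow> 'a"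
  proof -
    have "{x<..<y} \<times> (UNIV :: 'a set) \<in> sets borel"
      by (intro borel_open open_Times) auto
    then show ?thesis
      by (intro borel_measurable_restrict_space_iff) simp
  qed
  have "(\<lambda>z. indicator ({a<..<b} \<times> UNIV) z *\<^sub>R (case z of (\<tau>, x) \<Rightarrow> v1 \<tau> x) +
      indicator ({b<..<c} \<times> UNIV) z *\<^sub>R (case z of (\<tau>, x) \<Rightarrow> v2 \<tau> x)) \<in> borel_measurable borel"
    using v1 v2 unfolding velocity_field_def meas by (intro borel_measurable_add) auto
  also have "(\<lambda>z. indicator ({a<..<b} \<times> UNIV) z *\<^sub>R (case z of (\<tau>, x) \<Rightarrow> v1 \<tau> x) +
      indicator ({b<..<c} \<times> UNIV) z *\<^sub>R (case z of (\<tau>, x) \<Rightarrow> v2 \<tau> x)) =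
    (\<lambda>z. indicator ({a<..<c} \<times> UNIV) z *\<^sub>R (case z of (\<tau>, x) \<Rightarrow> ?v \<tau> x))"
    using abc by (auto simp: fun_eq_iff indicator_def concat_field_def)
  finally show "(\<lambda>(\<tau>, x). ?v \<tau> x) \<in> borel_measurable (restrict_space borel ({a<..<c} \<times> UNIV))"
    unfolding meas .
  have "(\<integral>\<^sup>+\<tau>\<in>{a<..<c}. (\<integral>\<^sup>+x. ennreal ((norm (?v \<tau> x))\<^sup>2) \<partial>?\<rho> \<tau>) \<partial>lborel) =
      (\<integral>\<^sup>+\<tau>\<in>{a<..<b}. (\<integral>\<^sup>+x. ennreal ((norm (v1 \<tau> x))\<^sup>2) \<partial>\<rho>1 \<tau>) \<partial>lborel) +
      (\<integral>\<^sup>+\<tau>\<in>{b<..<c}. (\<integral>\<^sup>+x. ennreal ((norm (v2 \<tau> x))\<^sup>2) \<partial>\<rho>2 \<tau>) \<partial>lborel)"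
    unfolding nn_integral_split_interval[OF abc]
    by (intro arg_cong2[where f = "(+)"] nn_integral_cong) (auto simp: indicator_def left right)
  also have "\<dots> < \<infinity>"
    using v1 v2 by (auto simp: velocity_field_def)
  finally show "(\<integral>\<^sup>+\<tau>\<in>{a<..<c}. (\<integral>\<^sup>+x. ennreal ((norm (?v \<tau> x))\<^sup>2) \<partial>?\<rho> \<tau>) \<partial>lborel) < \<infinity>" .
  fix \<phi> :: "real \<times> 'a \<Rightarrow> real" assume \<phi>: "test_function ({a<..<c} \<times> UNIV) \<phi>"
  let ?h = "\<lambda>\<rho> v \<tau>. \<integral>x. frechet_derivative \<phi> (at (\<tau>, x)) (1, v \<tau> x) \<partial>\<rho> \<tau>"
  have ends: "\<phi> (a, x) = 0" "\<phi> (c, x) = 0" for x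
  proof -
    have "(a, x) \<notin> closure {z. \<phi> z \<noteq> 0}" "(c, x) \<notin> closure {z. \<phi> z \<noteq> 0}"
      using \<phi> unfolding test_function_def by fastforce+
    then show "\<phi> (a, x) = 0" "\<phi> (c, x) = 0"
      using test_function_derivative(4)[OF \<phi>] by blast+
  qed
  have i1: "integrable lborel (\<lambda>\<tau>. indicator {a<..<b} \<tau> *\<^sub>R ?h \<rho>1 v1 \<tau>)"
    using velocity_field_pairing(2)[OF _ \<rho>1 v1 \<phi>] abc unfolding set_integrable_def by simp
  have i2: "integrable lborel (\<lambda>\<tau>. indicator {b<..<c} \<tau> *\<^sub>R ?h \<rho>2 v2 \<tau>)"
    using velocity_field_pairing(2)[OF _ \<rho>2 v2 \<phi>] abc unfolding set_integrable_def by simp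
  \<comment> \<open>At time \<open>b\<close> the integrand is some unspecified number; it is kept as a term of its own so that
    the decomposition below holds pointwise.\<close>
  have i3: "integrable lborel (\<lambda>\<tau>. indicator {b} \<tau> *\<^sub>R ?h ?\<rho> ?v b)" "(\<integral>\<tau>. indicator {b} \<tau> *\<^sub>R ?h ?\<rho> ?v b \<partial>lborel) = 0"
    by auto
  have "(LBINT \<tau>:{a<..<c}. ?h ?\<rho> ?v \<tau>) = (\<integral>\<tau>. indicator {a<..<b} \<tau> *\<^sub>R ?h \<rho>1 v1 \<tau> +
      indicator {b<..<c} \<tau> *\<^sub>R ?h \<rho>2 v2 \<tau> + indicator {b} \<tau> *\<^sub>R ?h ?\<rho> ?v b \<partial>lborel)"
    unfolding set_lebesgue_integral_def
  proof (rule Bochner_Integration.integral_cong)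
    fix \<tau>
    consider "\<tau> \<in> {a<..<b}" | "\<tau> \<in> {b<..<c}" | "\<tau> = b" | "\<tau> \<notin> {a<..<c}"
      by fastforce
    then show "indicator {a<..<c} \<tau> *\<^sub>R ?h ?\<rho> ?v \<tau> = indicator {a<..<b} \<tau> *\<^sub>R ?h \<rho>1 v1 \<tau> +
      indicator {b<..<c} \<tau> *\<^sub>R ?h \<rho>2 v2 \<tau> + indicator {b} \<tau> *\<^sub>R ?h ?\<rho> ?v b"
    proof cases
      case 1
      then show ?thesis using abc left[OF 1] by simp
    next
      case 2
      then show ?thesis using abc right[OF 2] by simp
    qed (use abc in \<open>auto simp: indicator_def\<close>)
  qed simp
  also have "\<dots> = (LBINT \<tau>:{a<..<b}. ?h \<rho>1 v1 \<tau>) + (LBINT \<tau>:{b<..<c}. ?h \<rho>2 v2 \<tau>)"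
    unfolding set_lebesgue_integral_def using i1 i2 i3 by simp
  also have "\<dots> = 0"
    unfolding continuity_equation_boundary_terms[OF abc(1) \<rho>1 v1 \<phi>] continuity_equation_boundary_terms[OF abc(2) \<rho>2 v2 \<phi>]
    by (simp add: ends eq)
  finally show "(LBINT \<tau>:{a<..<c}. ?h ?\<rho> ?v \<tau>) = 0" .
qed

lemma curves_ending_at_restrict:
  assumes "(\<rho>, v) \<in> curves_ending_at a c \<mu>" "a < b" "b < c"
  shows "(\<rho>, v) \<in> curves_ending_at a b (\<rho> b)" and "(\<rho>, v) \<in> curves_ending_at b c \<mu>"
  using assms AC2_subinterval[of \<rho> a c] velocity_field_subinterval[of a c \<rho> v]
  by (auto simp: curves_ending_at_def)

lemma curves_ending_at_concat:
  assumes "(\<rho>1, v1) \<in> curves_ending_at a b (\<rho>2 b)" "(\<rho>2, v2) \<in> curves_ending_at b c \<mu>" "a < b" "b < c"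
  shows "(concat_curve b \<rho>1 \<rho>2, concat_field b v1 v2) \<in> curves_ending_at a c \<mu>"
  using assms AC2_concat[of \<rho>1 a b \<rho>2 c] velocity_field_concat[of a b \<rho>1 c \<rho>2 v1 v2]
  by (auto simp: curves_ending_at_def AC2_def concat_curve_def)

section \<open>The dynamic programming principle\<close>

text \<open>A finite \<open>c\<close> can be moved to the other side of the inequality. If \<open>c = \<infinity>\<close>, the right-hand side
  is \<open>\<infinity>\<close>, even for infimum \<open>- \<infinity>\<close>, by the convention \<open>- \<infinity> + \<infinity> = \<infinity>\<close> of extended reals.\<close>
lemma INF_ereal_add_nonneg_ge:
  fixes f :: "'b \<Rightarrow> ereal"
  assumes "0 \<le> c" and le: "\<And>i. i \<in> I \<Longrightarrow> x \<le> f i + c"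
  shows "x \<le> (INF i\<in>I. f i) + c"
proof (cases "c = \<infinity>")
  case False
  then have c: "\<bar>c\<bar> \<noteq> \<infinity>" using assms(1) by auto
  have "x - c \<le> (INF i\<in>I. f i)"
    using le c by (intro INF_greatest) (simp add: ereal_minus_le)
  then show ?thesis
    using c by (simp add: ereal_minus_le)
qed simp

theorem lemma3p1:
  fixes E :: "real \<Rightarrow> 'a::euclidean_space measure \<Rightarrow> real"
    and V0 :: "'a measure \<Rightarrow> real"
    and s t :: real
    and \<mu> :: "'a measure"
  assumes "\<And>\<tau> \<nu>. 0 \<le> \<tau> \<Longrightarrow> \<nu> \<in> P2 \<Longrightarrow> 0 \<le> E \<tau> \<nu>"
    and "bdd_below (V0 ` P2)"
    and "0 \<le> s" and "s < t"
    and "\<mu> \<in> P2"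
  shows "value_function E V0 t \<mu> =
    (INF (\<rho>, v)\<in>curves_ending_at s t \<mu>.
       value_function E V0 s (\<rho> s) + kinetic_action s t \<rho> v + potential_action E s t \<rho>)"
proof (cases "s = 0")
  case True
  then show ?thesis
    using \<open>s < t\<close> by (simp add: value_function_def)
next
  case False
  then have s: "0 < s" using \<open>0 \<le> s\<close> by simp
  let ?J = "\<lambda>\<rho> v. ereal (V0 (\<rho> 0)) + kinetic_action 0 s \<rho> v + potential_action E 0 s \<rho>"
  let ?R = "INF (\<rho>, v)\<in>curves_ending_at s t \<mu>.
       value_function E V0 s (\<rho> s) + kinetic_action s t \<rho> v + potential_action E s t \<rho>"
  have Vs: "value_function E V0 s \<nu> = (INF (\<rho>, v)\<in>curves_ending_at 0 s \<nu>. ?J \<rho> v)" for \<nu>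
    using s by (simp add: value_function_def)
  have Vt: "value_function E V0 t \<nu> = (INF (\<rho>, v)\<in>curves_ending_at 0 t \<nu>.
      ereal (V0 (\<rho> 0)) + kinetic_action 0 t \<rho> v + potential_action E 0 t \<rho>)" for \<nu>
    using s \<open>s < t\<close> by (simp add: value_function_def)
  have split: "ereal (V0 (\<rho> 0)) + kinetic_action 0 t \<rho> v + potential_action E 0 t \<rho> =
      ?J \<rho> v + (kinetic_action s t \<rho> v + potential_action E s t \<rho>)" for \<rho> v
    unfolding kinetic_action_split[OF s \<open>s < t\<close>] potential_action_split[OF s \<open>s < t\<close>]
    by (simp add: ac_simps)
  show ?thesis
  proof (rule antisym)
    \<comment> \<open>Every competitor for time \<open>t\<close>, cut at time \<open>s\<close>, is a competitor on both pieces.\<close>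
    show "?R \<le> value_function E V0 t \<mu>"
      unfolding Vt
    proof (rule INF_greatest, clarify)
      fix \<rho> v assume \<rho>v: "(\<rho>, v) \<in> curves_ending_at 0 t \<mu>"
      note restr = curves_ending_at_restrict[OF \<rho>v s \<open>s < t\<close>]
      have "?R \<le> value_function E V0 s (\<rho> s) + kinetic_action s t \<rho> v + potential_action E s t \<rho>"
        using INF_lower[OF restr(2), of "\<lambda>(\<rho>, v). value_function E V0 s (\<rho> s) + kinetic_action s t \<rho> v + potential_action E s t \<rho>"]
        by simp
      also have "\<dots> = value_function E V0 s (\<rho> s) + (kinetic_action s t \<rho> v + potential_action E s t \<rho>)"
        by (rule add.assoc)
      also have "\<dots> \<le> ?J \<rho> v + (kinetic_action s t \<rho> v + potential_action E s t \<rho>)"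
        using INF_lower[OF restr(1), of "\<lambda>(\<rho>, v). ?J \<rho> v"] unfolding Vs by (intro add_right_mono) simp
      finally show "?R \<le> ereal (V0 (\<rho> 0)) + kinetic_action 0 t \<rho> v + potential_action E 0 t \<rho>"
        unfolding split .
    qed
    \<comment> \<open>Conversely, every competitor on \<open>[s, t]\<close> is prolonged backwards by an arbitrary competitor for
      the value at time \<open>s\<close>, and the infimum is taken over the latter.\<close>
    show "value_function E V0 t \<mu> \<le> ?R"
    proof (rule INF_greatest, clarify)
      fix \<rho>2 v2 assume 2: "(\<rho>2, v2) \<in> curves_ending_at s t \<mu>"
      let ?c = "kinetic_action s t \<rho>2 v2 + potential_action E s t \<rho>2"
      have "value_function E V0 t \<mu> \<le> (case p of (\<rho>1, v1) \<Rightarrow> ?J \<rho>1 v1) + ?c"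
        if "p \<in> curves_ending_at 0 s (\<rho>2 s)" for p
      proof -
        obtain \<rho>1 v1 where p: "p = (\<rho>1, v1)" by (cases p)
        let ?\<rho> = "concat_curve s \<rho>1 \<rho>2" and ?v = "concat_field s v1 v2"
        have "(?\<rho>, ?v) \<in> curves_ending_at 0 t \<mu>"
          using that 2 s \<open>s < t\<close> unfolding p by (intro curves_ending_at_concat)
        from INF_lower[OF this, of "\<lambda>(\<rho>, v). ereal (V0 (\<rho> 0)) + kinetic_action 0 t \<rho> v + potential_action E 0 t \<rho>"]
        have "value_function E V0 t \<mu> \<le> ?J ?\<rho> ?v + (kinetic_action s t ?\<rho> ?v + potential_action E s t ?\<rho>)"
          unfolding Vt split by simp
        moreover have "kinetic_action 0 s ?\<rho> ?v = kinetic_action 0 s \<rho>1 v1"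
          "potential_action E 0 s ?\<rho> = potential_action E 0 s \<rho>1"
          "kinetic_action s t ?\<rho> ?v = kinetic_action s t \<rho>2 v2"
          "potential_action E s t ?\<rho> = potential_action E s t \<rho>2"
          by (intro action_cong; auto simp: concat_curve_def concat_field_def fun_eq_iff)+
        moreover have "?\<rho> 0 = \<rho>1 0"
          using s by (simp add: concat_curve_def)
        ultimately show ?thesis
          by (simp add: p)
      qed
      then have "value_function E V0 t \<mu> \<le> value_function E V0 s (\<rho>2 s) + ?c"
        unfolding Vs by (intro INF_ereal_add_nonneg_ge add_nonneg_nonneg kinetic_action_nonneg potential_action_nonneg)
      then show "value_function E V0 t \<mu> \<le>
          value_function E V0 s (\<rho>2 s) + kinetic_action s t \<rho>2 v2 + potential_action E s t \<rho>2"
        by (simp add: add.assoc)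
    qed
  qed
qed

end
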